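(* Let $(M_1\times_{f_1}M_2,F)$ be a warped product Finsler manifold with relatively isotropic mean Landsberg curvature, i.e. ${\bf J}=cF\,{\bf I}$ for some scalar function $c$ on $M_1\times M_2$. Then it is a weakly Landsberg manifold, i.e. ${\bf J}=0$.
   Context: A Finsler metric on a smooth manifold $N$ is a function $F:TN\to[0,\infty)$ that is $C^\infty$ off the zero section, positively 1-homogeneous on fibers, and whose fundamental tensor $g_{ij}=\frac12\frac{\partial^2F^2}{\partial y^i\partial y^j}$ is positive definite at every nonzero $y$, where $(x^i,y^i)$ are standard coordinates on $TN$. $(g^{ij})$ is the inverse matrix of $(g_{ij})$ and $y_l=g_{lk}y^k$. Warped product (WP): given Finsler manifolds $(M_1,F_1)$, $(M_2,F_2)$ and a smooth function $f_1:M_1\to\mathbb{R}^+$, the WP-Finsler manifold $(M_1\times_{f_1}M_2,F)$ is $M_1\times M_2$ with $F(v_1,v_2)=\sqrt{F_1^2(v_1)+f_1^2(\pi_1(v_1))F_2^2(v_2)}$, where $\pi_1(v_1)$ is the base point of $v_1$. $F$ is considered on $TM_1^\circ\times TM_2^\circ$, where $TM_i^\circ=TM_i\setminus\{0\}$, and all tensors of $F$ are taken there. Tensors of a Finsler metric: the Cartan torsion is $C_{ijk}=\frac12\frac{\partial g_{ij}}{\partial y^k}$ and the mean Cartan torsion ${\bf I}$ has components $I_i=g^{jk}C_{ijk}$; the spray coefficients are $G^i=\frac14g^{il}\{\frac{\partial^2F^2}{\partial x^k\partial y^l}y^k-\frac{\partial F^2}{\partial x^l}\}$; the Berwald curvature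 is $B^i_{\ jkl}=\frac{\partial^3G^i}{\partial y^j\partial y^k\partial y^l}$; the Landsberg curvature is $L_{ijk}=-\frac12y_lB^l_{\ ijk}$; the mean Landsberg curvature ${\bf J}$ has components $J_i=g^{jk}L_{ijk}$. *)

theory Defs
  imports "HOL-Analysis.Analysis"
begin

section \<open>Smooth manifolds\<close>

text \<open>Being \<open>C\<^sup>\<infinity>\<close> on a set; only used for open sets.\<close>

primrec k_times_differentiable_on ::
    "nat \<Rightarrow> 'a::real_normed_vector set \<Rightarrow> ('a \<Rightarrow> 'b::real_normed_vector) \<Rightarrow> bool" where
  "k_times_differentiable_on 0 S f \<longleftrightarrow> continuous_on S f"
| "k_times_differentiable_on (Suc k) S f \<longleftrightarrow>
     (\<forall>x\<in>S. f differentiable (at x)) \<and>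
     (\<forall>v. k_times_differentiable_on k S (\<lambda>x. frechet_derivative f (at x) v))"

definition smooth_on :: "'a::real_normed_vector set \<Rightarrow> ('a \<Rightarrow> 'b::real_normed_vector) \<Rightarrow> bool" where
  "smooth_on S f \<longleftrightarrow> (\<forall>k. k_times_differentiable_on k S f)"

text \<open>A chart is a domain together with a coordinate map; only the values of the map on the
  domain matter. The dimension of the manifold is the cardinality of the index type \<open>'n\<close>.\<close>

type_synonym ('a, 'n) chart = "'a set \<times> ('a \<Rightarrow> real ^ 'n)"

abbreviation chart_dom :: "('a, 'n) chart \<Rightarrow> 'a set" where
  "chart_dom c \<equiv> fst c"

abbreviation coords :: "('a, 'n) chart \<Rightarrow> 'a \<Rightarrow> real ^ 'n" where
  "coords c \<equiv> snd c"

definition chart_image :: "('a, 'n) chart \<Rightarrow> (real ^ 'n) set" where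
  "chart_image c = coords c ` chart_dom c"

definition chart_inv :: "('a, 'n) chart \<Rightarrow> real ^ 'n \<Rightarrow> 'a" where
  "chart_inv c = inv_into (chart_dom c) (coords c)"

text \<open>The atlas is not required to be maximal.\<close>

definition smooth_manifold :: "'a topology \<Rightarrow> ('a, 'n::finite) chart set \<Rightarrow> bool" where
  "smooth_manifold X \<A> \<longleftrightarrow>
     Hausdorff_space X \<and> second_countable X \<and>
     (\<Union>c\<in>\<A>. chart_dom c) = topspace X \<and>
     (\<forall>c\<in>\<A>. openin X (chart_dom c) \<and> open (chart_image c) \<and>
        homeomorphic_map (subtopology X (chart_dom c)) (top_of_set (chart_image c)) (coords c)) \<and>
     (\<forall>c\<in>\<A>. \<forall>d\<in>\<A>.
        smooth_on (coords c ` (chart_dom c \<inter> chart_dom d)) (coords d \<circ> chart_inv c))"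

definition smooth_functions :: "('a, 'n::finite) chart set \<Rightarrow> ('a \<Rightarrow> real) set" where
  "smooth_functions \<A> = {f. \<forall>c\<in>\<A>. smooth_on (chart_image c) (f \<circ> chart_inv c)}"


section \<open>Tangent vectors\<close>

text \<open>Tangent vectors at \<open>p\<close> are the derivations at \<open>p\<close> of the algebra of smooth functions,
  extended by \<open>0\<close> to non-smooth functions so that they are determined by their values
  on smooth ones.\<close>

type_synonym 'a tvec = "('a \<Rightarrow> real) \<Rightarrow> real"

abbreviation zero_tvec :: "'a tvec" where
  "zero_tvec \<equiv> (\<lambda>f. 0)"

definition tangent_space :: "('a, 'n::finite) chart set \<Rightarrow> 'a \<Rightarrow> 'a tvec set" where
  "tangent_space \<A> p = {v.
     (\<forall>f. f \<notin> smooth_functions \<A> \<longrightarrow> v f = 0) \<and>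
     (\<forall>f\<in>smooth_functions \<A>. \<forall>a. v (\<lambda>x. a * f x) = a * v f) \<and>
     (\<forall>f\<in>smooth_functions \<A>. \<forall>g\<in>smooth_functions \<A>.
        v (\<lambda>x. f x + g x) = v f + v g \<and>
        v (\<lambda>x. f x * g x) = f p * v g + g p * v f)}"

definition tangent_bundle :: "('a, 'n::finite) chart set \<Rightarrow> ('a \<times> 'a tvec) set" where
  "tangent_bundle \<A> = {(p, v). p \<in> (\<Union>c\<in>\<A>. chart_dom c) \<and> v \<in> tangent_space \<A> p}"

text \<open>The differential of a smooth map \<open>h\<close> into the manifold with atlas \<open>\<B>\<close>.\<close>

definition differential ::
    "('b, 'n::finite) chart set \<Rightarrow> ('a \<Rightarrow> 'b) \<Rightarrow> 'a tvec \<Rightarrow> 'b tvec" where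
  "differential \<B> h v = (\<lambda>f. if f \<in> smooth_functions \<B> then v (f \<circ> h) else 0)"

definition partial_deriv :: "'n::finite \<Rightarrow> (real ^ 'n \<Rightarrow> real) \<Rightarrow> real ^ 'n \<Rightarrow> real" where
  "partial_deriv i h z = deriv (\<lambda>t. h (z + t *\<^sub>R axis i 1)) 0"

text \<open>The tangent vector \<open>\<Sum>\<^sub>i y\<^sup>i \<partial>/\<partial>x\<^sup>i\<close> at the point with coordinates \<open>x\<close> in the chart \<open>c\<close>.\<close>

definition coord_vec ::
    "('a, 'n::finite) chart set \<Rightarrow> ('a, 'n) chart \<Rightarrow> real ^ 'n \<Rightarrow> real ^ 'n \<Rightarrow> 'a tvec" where
  "coord_vec \<A> c x y = (\<lambda>f. if f \<in> smooth_functions \<A>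
     then \<Sum>i\<in>UNIV. y $ i * partial_deriv i (f \<circ> chart_inv c) x else 0)"


section \<open>Local tensors\<close>

text \<open>Here \<open>H\<close> is a function of the standard coordinates \<open>(x, y)\<close> of the tangent bundle.\<close>

type_synonym 'n coord_fun = "real ^ 'n \<Rightarrow> real ^ 'n \<Rightarrow> real"

definition deriv_x :: "'n::finite \<Rightarrow> 'n coord_fun \<Rightarrow> 'n coord_fun" where
  "deriv_x i H = (\<lambda>x y. partial_deriv i (\<lambda>z. H z y) x)"

definition deriv_y :: "'n::finite \<Rightarrow> 'n coord_fun \<Rightarrow> 'n coord_fun" where
  "deriv_y i H = (\<lambda>x y. partial_deriv i (H x) y)"

definition sq :: "'n::finite coord_fun \<Rightarrow> 'n coord_fun" where
  "sq H = (\<lambda>x y. (H x y)\<^sup>2)"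

definition fund_tensor :: "'n::finite coord_fun \<Rightarrow> 'n \<Rightarrow> 'n \<Rightarrow> 'n coord_fun" where
  "fund_tensor H i j = (\<lambda>x y. 1/2 * deriv_y i (deriv_y j (sq H)) x y)"

definition fund_inverse :: "'n::finite coord_fun \<Rightarrow> 'n \<Rightarrow> 'n \<Rightarrow> 'n coord_fun" where
  "fund_inverse H i j = (\<lambda>x y. matrix_inv (\<chi> k l. fund_tensor H k l x y) $ i $ j)"

definition y_lower :: "'n::finite coord_fun \<Rightarrow> 'n \<Rightarrow> 'n coord_fun" where
  "y_lower H l = (\<lambda>x y. \<Sum>k\<in>UNIV. fund_tensor H l k x y * y $ k)"

definition cartan_torsion :: "'n::finite coord_fun \<Rightarrow> 'n \<Rightarrow> 'n \<Rightarrow> 'n \<Rightarrow> 'n coord_fun" where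
  "cartan_torsion H i j k = (\<lambda>x y. 1/2 * deriv_y k (fund_tensor H i j) x y)"

definition mean_cartan_torsion :: "'n::finite coord_fun \<Rightarrow> 'n \<Rightarrow> 'n coord_fun" where
  "mean_cartan_torsion H i = (\<lambda>x y. \<Sum>j\<in>UNIV. \<Sum>k\<in>UNIV.
     fund_inverse H j k x y * cartan_torsion H i j k x y)"

definition spray_coeff :: "'n::finite coord_fun \<Rightarrow> 'n \<Rightarrow> 'n coord_fun" where
  "spray_coeff H i = (\<lambda>x y. 1/4 * (\<Sum>l\<in>UNIV. fund_inverse H i l x y *
     ((\<Sum>k\<in>UNIV. deriv_x k (deriv_y l (sq H)) x y * y $ k) - deriv_x l (sq H) x y)))"

text \<open>\<open>berwald H i j k l\<close> is \<open>B\<^sup>i\<^sub>j\<^sub>k\<^sub>l\<close>, with the upper index first.\<close>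

definition berwald :: "'n::finite coord_fun \<Rightarrow> 'n \<Rightarrow> 'n \<Rightarrow> 'n \<Rightarrow> 'n \<Rightarrow> 'n coord_fun" where
  "berwald H i j k l = deriv_y j (deriv_y k (deriv_y l (spray_coeff H i)))"

definition landsberg :: "'n::finite coord_fun \<Rightarrow> 'n \<Rightarrow> 'n \<Rightarrow> 'n \<Rightarrow> 'n coord_fun" where
  "landsberg H i j k = (\<lambda>x y. - 1/2 * (\<Sum>l\<in>UNIV. y_lower H l x y * berwald H l i j k x y))"

definition mean_landsberg :: "'n::finite coord_fun \<Rightarrow> 'n \<Rightarrow> 'n coord_fun" where
  "mean_landsberg H i = (\<lambda>x y. \<Sum>j\<in>UNIV. \<Sum>k\<in>UNIV.
     fund_inverse H j k x y * landsberg H i j k x y)"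


section \<open>Finsler manifolds\<close>

definition coord_rep ::
    "('a, 'n::finite) chart set \<Rightarrow> ('a, 'n) chart \<Rightarrow> ('a \<Rightarrow> 'a tvec \<Rightarrow> real) \<Rightarrow> 'n coord_fun" where
  "coord_rep \<A> c F = (\<lambda>x y. F (chart_inv c x) (coord_vec \<A> c x y))"

definition finsler_metric ::
    "('a, 'n::finite) chart set \<Rightarrow> ('a \<Rightarrow> 'a tvec \<Rightarrow> real) \<Rightarrow> bool" where
  "finsler_metric \<A> F \<longleftrightarrow>
     (\<forall>(p, v)\<in>tangent_bundle \<A>. F p v \<ge> 0) \<and>
     (\<forall>c\<in>\<A>. smooth_on (chart_image c \<times> (- {0})) (\<lambda>(x, y). coord_rep \<A> c F x y)) \<and>
     (\<forall>(p, v)\<in>tangent_bundle \<A>. \<forall>r>0. F p (\<lambda>f. r * v f) = r * F p v) \<and>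
     (\<forall>c\<in>\<A>. \<forall>x\<in>chart_image c. \<forall>y. y \<noteq> 0 \<longrightarrow>
        (\<forall>w. w \<noteq> 0 \<longrightarrow>
          (\<Sum>i\<in>UNIV. \<Sum>j\<in>UNIV. fund_tensor (coord_rep \<A> c F) i j x y * w $ i * w $ j) > 0))"

definition finsler_manifold ::
    "'a topology \<Rightarrow> ('a, 'n::finite) chart set \<Rightarrow> ('a \<Rightarrow> 'a tvec \<Rightarrow> real) \<Rightarrow> bool" where
  "finsler_manifold X \<A> F \<longleftrightarrow> smooth_manifold X \<A> \<and> finsler_metric \<A> F"

text \<open>The curvature conditions are imposed on a region \<open>D\<close> of the tangent bundle, because a warped
  product metric is in general smooth only where both components of the vector are nonzero.\<close>

definition weakly_landsberg_on ::
    "('a \<times> 'a tvec) set \<Rightarrow> ('a, 'n::finite) chart set \<Rightarrow> ('a \<Rightarrow> 'a tvec \<Rightarrow> real) \<Rightarrow> bool" where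
  "weakly_landsberg_on D \<A> F \<longleftrightarrow>
     (\<forall>c\<in>\<A>. \<forall>x\<in>chart_image c. \<forall>y. (chart_inv c x, coord_vec \<A> c x y) \<in> D \<longrightarrow>
        (\<forall>i. mean_landsberg (coord_rep \<A> c F) i x y = 0))"

definition rel_isotropic_mean_landsberg_on ::
    "('a \<times> 'a tvec) set \<Rightarrow> ('a, 'n::finite) chart set \<Rightarrow> ('a \<Rightarrow> 'a tvec \<Rightarrow> real) \<Rightarrow> bool" where
  "rel_isotropic_mean_landsberg_on D \<A> F \<longleftrightarrow>
     (\<exists>\<kappa> :: 'a \<Rightarrow> real.
        \<forall>c\<in>\<A>. \<forall>x\<in>chart_image c. \<forall>y. (chart_inv c x, coord_vec \<A> c x y) \<in> D \<longrightarrow>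
        (\<forall>i. mean_landsberg (coord_rep \<A> c F) i x y =
          \<kappa> (chart_inv c x) * coord_rep \<A> c F x y * mean_cartan_torsion (coord_rep \<A> c F) i x y))"


section \<open>Warped products\<close>

definition prod_chart ::
    "('a, 'm::finite) chart \<Rightarrow> ('b, 'n::finite) chart \<Rightarrow> ('a \<times> 'b, 'm + 'n) chart" where
  "prod_chart c d = (chart_dom c \<times> chart_dom d,
     \<lambda>(p, q). \<chi> k. case k of Inl i \<Rightarrow> coords c p $ i | Inr j \<Rightarrow> coords d q $ j)"

definition prod_atlas ::
    "('a, 'm::finite) chart set \<Rightarrow> ('b, 'n::finite) chart set \<Rightarrow> ('a \<times> 'b, 'm + 'n) chart set" where
  "prod_atlas \<A> \<B> = {prod_chart c d | c d. c \<in> \<A> \<and> d \<in> \<B>}"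

definition warped_metric ::
    "('a, 'm::finite) chart set \<Rightarrow> ('b, 'n::finite) chart set \<Rightarrow> ('a \<Rightarrow> real) \<Rightarrow>
     ('a \<Rightarrow> 'a tvec \<Rightarrow> real) \<Rightarrow> ('b \<Rightarrow> 'b tvec \<Rightarrow> real) \<Rightarrow>
     'a \<times> 'b \<Rightarrow> ('a \<times> 'b) tvec \<Rightarrow> real" where
  "warped_metric \<A> \<B> f\<^sub>1 F\<^sub>1 F\<^sub>2 = (\<lambda>(p, q) v.
     sqrt ((F\<^sub>1 p (differential \<A> fst v))\<^sup>2 + (f\<^sub>1 p)\<^sup>2 * (F\<^sub>2 q (differential \<B> snd v))\<^sup>2))"

text \<open>The product of the slit tangent bundles, as a region of the tangent bundle of the product.\<close>

definition slit_product ::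
    "('a, 'm::finite) chart set \<Rightarrow> ('b, 'n::finite) chart set \<Rightarrow>
     (('a \<times> 'b) \<times> ('a \<times> 'b) tvec) set" where
  "slit_product \<A> \<B> = {(p, v) \<in> tangent_bundle (prod_atlas \<A> \<B>).
     differential \<A> fst v \<noteq> zero_tvec \<and> differential \<B> snd v \<noteq> zero_tvec}"

end

theory Submission
  imports Defs
begin

text \<open>
  In product coordinates \<open>F\<^sup>2 = A(x, y) + \<phi>(x) B(u, v)\<close> with \<open>\<phi> = f\<^sub>1\<^sup>2\<close>, so the fundamental tensor and its
  inverse are block diagonal and every spray coefficient is a sum of two products of a function of
  \<open>y\<close> and a function of \<open>v\<close>, each homogeneous. Fix the base point and \<open>(y, v)\<close> and consider a component
  of \<open>J = cFI\<close>. For an index in the first block scale \<open>v\<close> by \<open>t > 0\<close>, for one in the second block scale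
  \<open>y\<close>. Then \<open>I\<close> does not change, \<open>J\<close> becomes \<open>p/t + q + rt + st\<^sup>2\<close>, and \<open>F\<^sup>2\<close> becomes \<open>\<alpha> + \<beta>t\<^sup>2\<close> with
  \<open>\<alpha>, \<beta> > 0\<close>. Since \<open>\<alpha> + \<beta>t\<^sup>2\<close> is not the square of such a function, comparing coefficients in
  \<open>J\<^sup>2 = (cI)\<^sup>2F\<^sup>2\<close> gives \<open>cI = 0\<close>, hence \<open>J = 0\<close>.
\<close>

section \<open>Smooth functions\<close>

text \<open>The choice of which vector to scale is dictated by I: a component with index in one
  block depends on the vector of that block only, whereas F depends on both, so moving the other
  vector changes F and keeps I. The exponents -1, ..., 2 are sums of degrees of homogeneity. The
  factors of the spray coming from the warping have degree 0, 1 or 2, each Berwald index in the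
  scaled block lowers the degree by one, and y_l contributes 0 or 1. Only these degrees enter, not a
  formula for J. Since the base point is fixed, c is a single real number, and squaring replaces the
  root in F by the explicit sum. The obstacle is regularity: F is handled only where both vectors
  are nonzero, so every derivative is taken factor by factor, each factor being smooth off the zero
  vector of its own block. For the spray this rests on the smooth dependence of an inverse matrix on
  its entries.\<close>

lemma k_times_cong:
  assumes "open S" "\<And>x. x \<in> S \<Longrightarrow> f x = g x" "k_times_differentiable_on k S f"
  shows "k_times_differentiable_on k S g"
  using assms(2,3)
proof (induction k arbitrary: f g)
  case 0
  then show ?case by (simp cong: continuous_on_cong)
next
  case (Suc k)
  have der: "(g has_derivative frechet_derivative f (at x)) (at x)" if "x \<in> S" for x
  proof (rule has_derivative_transform_within_open[OF _ assms(1) that])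
    show "(f has_derivative frechet_derivative f (at x)) (at x)"
      using Suc.prems(2) that by (intro frechet_derivative_works[THEN iffD1]) auto
  qed (rule Suc.prems(1))
  have eq: "frechet_derivative f (at x) v = frechet_derivative g (at x) v" if "x \<in> S" for x v
    using frechet_derivative_at[OF der[OF that]] by simp
  have "k_times_differentiable_on k S (\<lambda>x. frechet_derivative f (at x) v)" for v
    using Suc.prems(2) by simp
  with eq have "k_times_differentiable_on k S (\<lambda>x. frechet_derivative g (at x) v)" for v
    by (rule Suc.IH)
  then show ?case
    using der by (auto simp: differentiable_def)
qed

text \<open>The product and reciprocal rules leave undifferentiated factors, which are known to
  order \<open>Suc k\<close> and wanted at order \<open>k\<close>.\<close>

lemma k_times_SucD:
  "k_times_differentiable_on (Suc k) S f \<Longrightarrow> k_times_differentiable_on k S f"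
proof (induction k arbitrary: f)
  case 0
  then show ?case
    by (auto simp: differentiable_imp_continuous_within continuous_at_imp_continuous_on)
next
  case (Suc k)
  then show ?case by simp
qed

lemma k_times_const: "k_times_differentiable_on k S (\<lambda>x. c)"
  by (induction k arbitrary: c) auto

text \<open>By uniqueness, any explicit derivative may stand for \<open>frechet_derivative\<close>.
  The inductions below rest on this: a differentiation rule supplies \<open>f'\<close>, and its
  directional values are built from functions covered by the induction hypothesis.\<close>

lemma k_times_SucI:
  assumes "open S" "\<And>x. x \<in> S \<Longrightarrow> (f has_derivative f' x) (at x)"
    "\<And>v. k_times_differentiable_on k S (\<lambda>x. f' x v)"
  shows "k_times_differentiable_on (Suc k) S f"
proof -
  have "f' x = frechet_derivative f (at x)" if "x \<in> S" for x
    using assms(2)[OF that] frechet_derivative_at by blast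
  then have "k_times_differentiable_on k S (\<lambda>x. frechet_derivative f (at x) v)" for v
    using assms(1,3) k_times_cong[of S "\<lambda>x. f' x v"] by auto
  then show ?thesis using assms(2) by (auto simp: differentiable_def)
qed

lemma k_times_has_derivative:
  "k_times_differentiable_on (Suc k) S f \<Longrightarrow> x \<in> S \<Longrightarrow>
    (f has_derivative frechet_derivative f (at x)) (at x)"
  by (simp add: frechet_derivative_works)

lemma k_times_add:
  assumes "open S" "k_times_differentiable_on k S f" "k_times_differentiable_on k S g"
  shows "k_times_differentiable_on k S (\<lambda>x. f x + g x)"
  using assms(2,3)
proof (induction k arbitrary: f g)
  case 0
  then show ?case by (auto intro: continuous_intros)
next
  case (Suc k)
  show ?case
  proof (rule k_times_SucI[OF assms(1)])
    show "((\<lambda>x. f x + g x) has_derivative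
       (\<lambda>v. frechet_derivative f (at x) v + frechet_derivative g (at x) v)) (at x)" if "x \<in> S" for x
      using Suc.prems that by (intro has_derivative_add k_times_has_derivative)
    show "k_times_differentiable_on k S
        (\<lambda>x. frechet_derivative f (at x) v + frechet_derivative g (at x) v)" for v
      using Suc.prems by (intro Suc.IH) auto
  qed
qed

lemma k_times_mult:
  fixes f g :: "'a::real_normed_vector \<Rightarrow> real"
  assumes "open S" "k_times_differentiable_on k S f" "k_times_differentiable_on k S g"
  shows "k_times_differentiable_on k S (\<lambda>x. f x * g x)"
  using assms(2,3)
proof (induction k arbitrary: f g)
  case 0
  then show ?case by (auto intro: continuous_intros)
next
  case (Suc k)
  show ?case
  proof (rule k_times_SucI[OF assms(1)])
    show "((\<lambda>x. f x * g x) has_derivative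
       (\<lambda>v. f x * frechet_derivative g (at x) v + frechet_derivative f (at x) v * g x)) (at x)"
      if "x \<in> S" for x
      using Suc.prems that by (intro has_derivative_mult k_times_has_derivative)
    show "k_times_differentiable_on k S
        (\<lambda>x. f x * frechet_derivative g (at x) v + frechet_derivative f (at x) v * g x)" for v
      using Suc.prems Suc.prems[THEN k_times_SucD]
      by (intro k_times_add assms(1) Suc.IH) auto
  qed
qed

lemma k_times_inverse:
  fixes f :: "'a::real_normed_vector \<Rightarrow> real"
  assumes "open S" "k_times_differentiable_on k S f" "\<And>x. x \<in> S \<Longrightarrow> f x \<noteq> 0"
  shows "k_times_differentiable_on k S (\<lambda>x. inverse (f x))"
  using assms(2,3)
proof (induction k arbitrary: f)
  case 0
  then show ?case by (auto intro: continuous_intros)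
next
  case (Suc k)
  show ?case
  proof (rule k_times_SucI[OF assms(1)])
    \<comment> \<open>The sign is written as a factor -1, so that the rules for products and
      constants cover the derivative.\<close>
    show "((\<lambda>x. inverse (f x)) has_derivative
       (\<lambda>v. (- 1) * (inverse (f x) * frechet_derivative f (at x) v * inverse (f x)))) (at x)"
      if "x \<in> S" for x
      using Deriv.has_derivative_inverse[OF Suc.prems(2)[OF that] k_times_has_derivative[OF Suc.prems(1) that]]
      by simp
    show "k_times_differentiable_on k S
        (\<lambda>x. (- 1) * (inverse (f x) * frechet_derivative f (at x) v * inverse (f x)))" for v
      using Suc.prems Suc.prems(1)[THEN k_times_SucD]
      by (intro k_times_mult k_times_const assms(1) Suc.IH) auto
  qed
qed

text \<open>For an affine inner map the chain rule yields the derivative of \<open>f\<close> in the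
  fixed direction \<open>L v\<close>, again composed with the same map, so the induction closes.
  This one form serves for slices, for coordinate projections and for restriction to a
  subset.\<close>

lemma k_times_affine:
  assumes "open S" "bounded_linear L" "\<And>x. x \<in> S \<Longrightarrow> c + L x \<in> T"
    "k_times_differentiable_on k T f"
  shows "k_times_differentiable_on k S (\<lambda>x. f (c + L x))"
  using assms(4)
proof (induction k arbitrary: f)
  case 0
  have "continuous_on S (f \<circ> (\<lambda>x. c + L x))"
    using 0 assms(2,3)
    by (intro continuous_on_compose continuous_on_subset[of T f "(\<lambda>x. c + L x) ` S"]
        continuous_on_add continuous_on_const linear_continuous_on[of L]) auto
  then show ?case by (simp add: o_def)
next
  case (Suc k)
  show ?case
  proof (rule k_times_SucI[OF assms(1)])
    show "((\<lambda>x. f (c + L x)) has_derivative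
       (\<lambda>v. frechet_derivative f (at (c + L x)) (L v))) (at x)" if "x \<in> S" for x
    proof -
      have "((\<lambda>x. c + L x) has_derivative L) (at x)"
        using has_derivative_add[OF has_derivative_const bounded_linear_imp_has_derivative[OF assms(2)]]
        by simp
      then show ?thesis
        using diff_chain_at[of "\<lambda>x. c + L x" L x f] k_times_has_derivative[OF Suc.prems assms(3)[OF that]]
        by (simp add: o_def)
    qed
    show "k_times_differentiable_on k S (\<lambda>x. frechet_derivative f (at (c + L x)) (L v))" for v
      using Suc.prems by (intro Suc.IH) auto
  qed
qed

lemma smooth_on_cong:
  "open S \<Longrightarrow> smooth_on S f \<Longrightarrow> (\<And>x. x \<in> S \<Longrightarrow> f x = g x) \<Longrightarrow> smooth_on S g"
  unfolding smooth_on_def using k_times_cong by blast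

lemma smooth_on_const: "smooth_on S (\<lambda>x. c)"
  by (simp add: smooth_on_def k_times_const)

lemma smooth_on_add:
  "open S \<Longrightarrow> smooth_on S f \<Longrightarrow> smooth_on S g \<Longrightarrow> smooth_on S (\<lambda>x. f x + g x)"
  by (simp add: smooth_on_def k_times_add)

lemma smooth_on_mult:
  fixes f g :: "'a::real_normed_vector \<Rightarrow> real"
  shows "open S \<Longrightarrow> smooth_on S f \<Longrightarrow> smooth_on S g \<Longrightarrow> smooth_on S (\<lambda>x. f x * g x)"
  by (simp add: smooth_on_def k_times_mult)

lemma smooth_on_diff:
  fixes f g :: "'a::real_normed_vector \<Rightarrow> real"
  assumes "open S" "smooth_on S f" "smooth_on S g"
  shows "smooth_on S (\<lambda>x. f x - g x)"
  using smooth_on_add[OF assms(1,2) smooth_on_mult[OF assms(1) smooth_on_const[of S "- 1"] assms(3)]]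
  by simp

lemma smooth_on_inverse:
  fixes f :: "'a::real_normed_vector \<Rightarrow> real"
  shows "open S \<Longrightarrow> smooth_on S f \<Longrightarrow> (\<And>x. x \<in> S \<Longrightarrow> f x \<noteq> 0) \<Longrightarrow>
    smooth_on S (\<lambda>x. inverse (f x))"
  by (simp add: smooth_on_def k_times_inverse)

lemma smooth_on_sum:
  assumes "open S" "\<And>i. i \<in> I \<Longrightarrow> smooth_on S (f i)"
  shows "smooth_on S (\<lambda>x. \<Sum>i\<in>I. f i x)"
  using assms(2)
  by (induction I rule: infinite_finite_induct) (auto intro: smooth_on_const smooth_on_add assms(1))

lemma smooth_on_prod:
  fixes f :: "'i \<Rightarrow> 'a::real_normed_vector \<Rightarrow> real"
  assumes "open S" "\<And>i. i \<in> I \<Longrightarrow> smooth_on S (f i)"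
  shows "smooth_on S (\<lambda>x. \<Prod>i\<in>I. f i x)"
  using assms(2)
  by (induction I rule: infinite_finite_induct) (auto intro: smooth_on_const smooth_on_mult assms(1))

lemma smooth_on_affine:
  assumes "open S" "bounded_linear L" "\<And>x. x \<in> S \<Longrightarrow> c + L x \<in> T" "smooth_on T f"
  shows "smooth_on S (\<lambda>x. f (c + L x))"
  unfolding smooth_on_def
  using assms(4) by (auto simp: smooth_on_def intro: k_times_affine[OF assms(1-3)])

lemma smooth_on_linear:
  assumes "bounded_linear f"
  shows "smooth_on UNIV f"
proof -
  have "k_times_differentiable_on (Suc k) UNIV f" for k
    using assms k_times_SucI[OF open_UNIV, of f "\<lambda>_. f"] bounded_linear_imp_has_derivative
    by (metis k_times_const)
  then show ?thesis unfolding smooth_on_def using k_times_SucD by blast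
qed

lemma smooth_on_subset:
  assumes "smooth_on T f" "open S" "S \<subseteq> T"
  shows "smooth_on S f"
  using smooth_on_affine[OF assms(2) bounded_linear_ident _ assms(1), of 0] assms(3) by auto

lemma smooth_on_frechet_derivative:
  "smooth_on S f \<Longrightarrow> smooth_on S (\<lambda>x. frechet_derivative f (at x) v)"
  unfolding smooth_on_def using k_times_differentiable_on.simps(2) by blast

lemma smooth_on_has_derivative:
  "smooth_on S f \<Longrightarrow> x \<in> S \<Longrightarrow> (f has_derivative frechet_derivative f (at x)) (at x)"
  unfolding smooth_on_def using k_times_has_derivative by blast

lemma smooth_on_differentiable: "smooth_on S f \<Longrightarrow> x \<in> S \<Longrightarrow> f differentiable (at x)"
  using smooth_on_has_derivative differentiable_def by blast

section \<open>Partial derivatives\<close>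

text \<open>The chain rule along a line. It serves coordinate lines, lines in a product space, and
  the radial line in Euler's relation.\<close>

lemma line_has_real_derivative:
  fixes h :: "'a::real_normed_vector \<Rightarrow> real"
  assumes "(h has_derivative D) (at (z + s *\<^sub>R v))"
  shows "((\<lambda>t. h (z + t *\<^sub>R v)) has_real_derivative D v) (at s)"
proof -
  have "((\<lambda>t. z + t *\<^sub>R v) has_derivative (\<lambda>t. t *\<^sub>R v)) (at s)"
    by (auto intro!: derivative_eq_intros)
  then have "((\<lambda>t. h (z + t *\<^sub>R v)) has_derivative (\<lambda>t. D (t *\<^sub>R v))) (at s)"
    using diff_chain_at[of "\<lambda>t. z + t *\<^sub>R v" _ s h D] assms by (simp add: o_def)
  moreover have "D (t *\<^sub>R v) = D v * t" for t
    using has_derivative_bounded_linear[OF assms] by (simp add: linear_simps)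
  ultimately show ?thesis by (simp add: has_field_derivative_def)
qed

text \<open>\<open>deriv\<close> is a choice that is meaningful only if the derivative exists;
  differentiability ties it to the Frechet derivative.\<close>

lemma partial_deriv_line:
  assumes "h differentiable (at z)"
  shows "((\<lambda>t. h (z + t *\<^sub>R axis i 1)) has_real_derivative partial_deriv i h z) (at 0)"
    and "partial_deriv i h z = frechet_derivative h (at z) (axis i 1)"
proof -
  have *: "((\<lambda>t. h (z + t *\<^sub>R axis i 1)) has_real_derivative
      frechet_derivative h (at z) (axis i 1)) (at 0)"
    using assms by (intro line_has_real_derivative) (simp add: frechet_derivative_works)
  then show "partial_deriv i h z = frechet_derivative h (at z) (axis i 1)"
    unfolding partial_deriv_def by (rule DERIV_imp_deriv)
  with * show "((\<lambda>t. h (z + t *\<^sub>R axis i 1)) has_real_derivative partial_deriv i h z) (at 0)"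
    by simp
qed

lemma partial_derivI:
  "((\<lambda>t. h (z + t *\<^sub>R axis i 1)) has_real_derivative D) (at 0) \<Longrightarrow> partial_deriv i h z = D"
  unfolding partial_deriv_def by (rule DERIV_imp_deriv)

lemma partial_deriv_cong:
  assumes "open S" "z \<in> S" "\<And>x. x \<in> S \<Longrightarrow> f x = g x"
  shows "partial_deriv i f z = partial_deriv i g z"
proof -
  have "((\<lambda>t. z + t *\<^sub>R axis i 1) \<longlongrightarrow> z + 0 *\<^sub>R axis i 1) (nhds 0)"
    by (intro tendsto_intros filterlim_ident)
  then have "eventually (\<lambda>t. z + t *\<^sub>R axis i 1 \<in> S) (nhds 0)"
    using assms(1,2) by (intro topological_tendstoD) auto
  then have "eventually (\<lambda>t. f (z + t *\<^sub>R axis i 1) = g (z + t *\<^sub>R axis i 1)) (nhds 0)"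
    by eventually_elim (use assms(3) in auto)
  then show ?thesis
    unfolding partial_deriv_def by (intro deriv_cong_ev) auto
qed

lemma partial_deriv_const [simp]: "partial_deriv i (\<lambda>z. c) = (\<lambda>z. 0)"
  by (simp add: partial_deriv_def fun_eq_iff)

lemma deriv_y_eq: "deriv_y i K x = partial_deriv i (K x)"
  by (simp add: deriv_y_def fun_eq_iff)

lemma deriv_x_eq: "deriv_x i K x y = partial_deriv i (\<lambda>x. K x y) x"
  by (simp add: deriv_x_def)

lemma smooth_on_partial_deriv:
  assumes "open S" "smooth_on S f"
  shows "smooth_on S (partial_deriv i f)"
  using smooth_on_cong[OF assms(1) smooth_on_frechet_derivative[OF assms(2), of "axis i 1"]]
    partial_deriv_line(2)[OF smooth_on_differentiable[OF assms(2)]]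
  by metis

lemma partial_deriv_add:
  assumes "f differentiable (at z)" "g differentiable (at z)"
  shows "partial_deriv i (\<lambda>x. f x + g x) z = partial_deriv i f z + partial_deriv i g z"
  by (intro partial_derivI DERIV_add partial_deriv_line assms)

lemma partial_deriv_cmult:
  assumes "f differentiable (at z)"
  shows "partial_deriv i (\<lambda>x. c * f x) z = c * partial_deriv i f z"
  by (intro partial_derivI DERIV_cmult partial_deriv_line assms)

lemma partial_deriv_mult:
  assumes "f differentiable (at z)" "g differentiable (at z)"
  shows "partial_deriv i (\<lambda>x. f x * g x) z = f z * partial_deriv i g z + g z * partial_deriv i f z"
  using DERIV_mult[OF partial_deriv_line(1)[OF assms(1)] partial_deriv_line(1)[OF assms(2)]]
  by (intro partial_derivI) (simp add: mult.commute add.commute)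

text \<open>From f(t z + s e_i) = c f(z + (s/t) e_i), differentiation in s gives the factor c/t: a
  partial derivative lowers the degree of homogeneity by one.\<close>

lemma partial_deriv_scale:
  assumes "open S" "z \<in> S" "t > 0" "f differentiable (at z)"
    and "\<And>x. x \<in> S \<Longrightarrow> f (t *\<^sub>R x) = c * f x"
  shows "partial_deriv i f (t *\<^sub>R z) = c / t * partial_deriv i f z"
proof (rule partial_derivI)
  have *: "((\<lambda>s. c * f (z + (s / t) *\<^sub>R axis i 1)) has_real_derivative
      c * (partial_deriv i f z * (1 / t))) (at 0)"
  proof (rule DERIV_cmult, rule DERIV_chain2[of "\<lambda>s. f (z + s *\<^sub>R axis i 1)"])
    show "((\<lambda>s. s / t) has_real_derivative 1 / t) (at 0)"
      using assms(3) by (auto intro!: derivative_eq_intros)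
  qed (use assms partial_deriv_line in auto)
  \<comment> \<open>For small \<open>s\<close> the shifted point stays in \<open>S\<close>, where
    the scaling law is available.\<close>
  have "((\<lambda>s. z + (s / t) *\<^sub>R axis i 1) \<longlongrightarrow> z + (0 / t) *\<^sub>R axis i 1) (nhds 0)"
    by (intro tendsto_intros filterlim_ident) (use assms(3) in auto)
  then have "eventually (\<lambda>s. z + (s / t) *\<^sub>R axis i 1 \<in> S) (nhds 0)"
    using assms(1,2) by (intro topological_tendstoD) auto
  then have "eventually (\<lambda>s. f (t *\<^sub>R z + s *\<^sub>R axis i 1) = c * f (z + (s / t) *\<^sub>R axis i 1)) (nhds 0)"
    by eventually_elim (use assms(3,5) in \<open>auto simp flip: assms(5) simp: algebra_simps\<close>)
  from DERIV_cong_ev[OF refl this refl] *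
  show "((\<lambda>s. f (t *\<^sub>R z + s *\<^sub>R axis i 1)) has_real_derivative c / t * partial_deriv i f z) (at 0)"
    by (simp add: mult.commute)
qed

section \<open>Functions of base point and vector: slices and partial derivatives\<close>

lemma smooth_on_case_prod_slice:
  assumes "open W" "smooth_on (U \<times> W) (\<lambda>(x, y). K x y)" "x \<in> U"
  shows "smooth_on W (K x)"
proof -
  have "smooth_on W (\<lambda>y. (\<lambda>(x, y). K x y) ((x, 0) + (0, y)))"
    using assms by (intro smooth_on_affine[where T = "U \<times> W"])
      (auto intro: bounded_linear_Pair bounded_linear_zero bounded_linear_ident)
  then show ?thesis by simp
qed

lemma smooth_on_case_prod_slice_fst:
  assumes "open U" "smooth_on (U \<times> W) (\<lambda>(x, y). K x y)" "y \<in> W"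
  shows "smooth_on U (\<lambda>x. K x y)"
proof -
  have "smooth_on U (\<lambda>x. (\<lambda>(x, y). K x y) ((0, y) + (x, 0)))"
    using assms by (intro smooth_on_affine[where T = "U \<times> W"])
      (auto intro: bounded_linear_Pair bounded_linear_zero bounded_linear_ident)
  then show ?thesis by simp
qed

text \<open>The fibre derivative is the Frechet derivative of the uncurried function in direction
  (0, e_i), hence joint smoothness is inherited.\<close>

lemma smooth_on_deriv_y:
  assumes "open U" "open W" "smooth_on (U \<times> W) (\<lambda>(x, y). K x y)"
  shows "smooth_on (U \<times> W) (\<lambda>(x, y). deriv_y i K x y)"
proof -
  let ?K = "\<lambda>(x, y). K x y"
  have "frechet_derivative ?K (at (x, y)) (0, axis i 1) = deriv_y i K x y"
    if "(x, y) \<in> U \<times> W" for x y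
  proof -
    have "(?K has_derivative frechet_derivative ?K (at (x, y))) (at ((x, y) + 0 *\<^sub>R (0, axis i 1)))"
      using smooth_on_has_derivative[OF assms(3) that] by simp
    from line_has_real_derivative[OF this] show ?thesis
      unfolding deriv_y_def by (intro partial_derivI[symmetric]) simp
  qed
  with smooth_on_frechet_derivative[OF assms(3), of "(0, axis i 1)"] assms(1,2) show ?thesis
    by (auto elim!: smooth_on_cong[rotated] simp: open_Times)
qed

lemma smooth_on_deriv_x:
  assumes "open U" "open W" "smooth_on (U \<times> W) (\<lambda>(x, y). K x y)"
  shows "smooth_on (U \<times> W) (\<lambda>(x, y). deriv_x i K x y)"
proof -
  let ?K = "\<lambda>(x, y). K x y"
  have "frechet_derivative ?K (at (x, y)) (axis i 1, 0) = deriv_x i K x y"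
    if "(x, y) \<in> U \<times> W" for x y
  proof -
    have "(?K has_derivative frechet_derivative ?K (at (x, y))) (at ((x, y) + 0 *\<^sub>R (axis i 1, 0)))"
      using smooth_on_has_derivative[OF assms(3) that] by simp
    from line_has_real_derivative[OF this] show ?thesis
      unfolding deriv_x_def by (intro partial_derivI[symmetric]) simp
  qed
  with smooth_on_frechet_derivative[OF assms(3), of "(axis i 1, 0)"] assms(1,2) show ?thesis
    by (auto elim!: smooth_on_cong[rotated] simp: open_Times)
qed

section \<open>Local Finsler functions\<close>

lemma open_nonzero [simp]: "open (- {0 :: 'a::real_normed_vector})"
  by (simp add: open_Compl)

section \<open>Inverse matrices and their smooth dependence on the entries\<close>

lemma matrix_inv_mult:
  "invertible A \<Longrightarrow> A ** matrix_inv A = mat 1 \<and> matrix_inv A ** A = mat 1"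
  unfolding matrix_inv_def invertible_def by (rule someI_ex)

text \<open>\<open>matrix_inv\<close> is a choice, so an explicit inverse is identified by
  uniqueness: a one-sided inverse of a square matrix is the inverse.\<close>

lemma matrix_inv_eqI:
  fixes A B :: "real^'n^'n"
  assumes "A ** B = mat 1"
  shows "matrix_inv A = B"
proof -
  have "matrix_inv A ** A = mat 1"
    using matrix_inv_mult assms invertible_right_inverse[of A] by blast
  then have "matrix_inv A ** (A ** B) = B"
    by (simp add: matrix_mul_assoc)
  with assms show ?thesis by simp
qed

text \<open>Column \<open>j\<close> of the inverse solves A x = e_j. Cramer's rule expresses it by
  determinants, which are polynomials in the entries; this is the source of smoothness.\<close>

lemma matrix_inv_cramer:
  fixes A :: "real^'n^'n"
  assumes "invertible A"
  shows "matrix_inv A $ i $ j =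
    det (\<chi> p q. if q = i then axis j 1 $ p else A $ p $ q) * inverse (det A)"
proof -
  let ?x = "matrix_inv A *v axis j 1"
  have "A *v ?x = axis j 1"
    using matrix_inv_mult[OF assms] by (simp add: matrix_vector_mul_assoc)
  then have "?x = (\<chi> k. det (\<chi> p q. if q = k then axis j 1 $ p else A $ p $ q) / det A)"
    using cramer[of A ?x "axis j 1"] assms by (simp add: invertible_det_nz)
  moreover have "?x $ i = matrix_inv A $ i $ j"
    by (simp add: matrix_vector_mult_basis column_def)
  ultimately show ?thesis by (simp add: divide_inverse)
qed

lemma smooth_on_det:
  fixes A :: "'a::real_normed_vector \<Rightarrow> real^'n^'n"
  assumes "open S" "\<And>i j. smooth_on S (\<lambda>x. A x $ i $ j)"
  shows "smooth_on S (\<lambda>x. det (A x))"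
  unfolding det_def using assms
  by (intro smooth_on_sum smooth_on_mult smooth_on_prod smooth_on_const) auto

lemma smooth_on_matrix_inv:
  fixes A :: "'a::real_normed_vector \<Rightarrow> real^'n^'n"
  assumes "open S" "\<And>i j. smooth_on S (\<lambda>x. A x $ i $ j)" "\<And>x. x \<in> S \<Longrightarrow> invertible (A x)"
  shows "smooth_on S (\<lambda>x. matrix_inv (A x) $ i $ j)"
proof -
  have "smooth_on S (\<lambda>x. (\<chi> p q. if q = i then axis j 1 $ p else A x $ p $ q) $ p $ q)" for p q
    using assms(2) smooth_on_const by (cases "q = i") auto
  with assms have "smooth_on S (\<lambda>x. det (\<chi> p q. if q = i then axis j 1 $ p else A x $ p $ q)
      * inverse (det (A x)))"
    by (intro smooth_on_mult smooth_on_det smooth_on_inverse) (auto simp: invertible_det_nz)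
  from assms(1) this show ?thesis
    by (rule smooth_on_cong) (simp add: matrix_inv_cramer[OF assms(3)])
qed

lemma frechet_derivative_eq_sum_partial_deriv:
  fixes f :: "real ^ 'n \<Rightarrow> real"
  assumes "f differentiable (at z)"
  shows "frechet_derivative f (at z) y = (\<Sum>i\<in>UNIV. y $ i * partial_deriv i f z)"
proof -
  interpret bounded_linear "frechet_derivative f (at z)"
    using assms frechet_derivative_works has_derivative_bounded_linear by blast
  have "frechet_derivative f (at z) (\<Sum>i\<in>UNIV. y $ i *\<^sub>R axis i 1)
      = (\<Sum>i\<in>UNIV. y $ i * partial_deriv i f z)"
    by (simp add: sum scale partial_deriv_line(2)[OF assms])
  then show ?thesis
    by (metis (no_types, lifting) basis_expansion scalar_mult_eq_scaleR sum.cong)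
qed

text \<open>Euler's relation: s \<mapsto> f((1 + s) y) is differentiated at 0 once by the chain rule
  and once as (1 + s)^d f(y).\<close>

lemma euler_homogeneous:
  fixes f :: "real ^ 'n \<Rightarrow> real"
  assumes "f differentiable (at y)" "\<And>t. t > 0 \<Longrightarrow> f (t *\<^sub>R y) = t ^ d * f y"
  shows "(\<Sum>i\<in>UNIV. y $ i * partial_deriv i f y) = real d * f y"
proof -
  have "((\<lambda>s. f (y + s *\<^sub>R y)) has_real_derivative frechet_derivative f (at y) y) (at 0)"
    using assms(1) by (intro line_has_real_derivative) (simp add: frechet_derivative_works)
  moreover have "((\<lambda>s. f (y + s *\<^sub>R y)) has_real_derivative real d * f y) (at 0)"
  \<comment> \<open>The bound s > -1 keeps 1 + s positive, as the scaling law requires.\<close>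
  proof (rule has_field_derivative_transform_within_open[where S = "{-1<..}"])
    show "((\<lambda>s. (1 + s) ^ d * f y) has_real_derivative real d * f y) (at 0)"
      by (auto intro!: derivative_eq_intros)
    show "(1 + s) ^ d * f y = f (y + s *\<^sub>R y)" if "s \<in> {-1<..}" for s
      using assms(2)[of "1 + s"] that by (simp add: scaleR_add_left)
  qed auto
  ultimately show ?thesis
    using frechet_derivative_eq_sum_partial_deriv[OF assms(1)] DERIV_unique by metis
qed

text \<open>A Finsler metric as seen in one chart, with \<open>U\<close> the chart image. All tensor
  calculus happens here, free of manifolds.\<close>

locale local_finsler =
  fixes U :: "(real ^ 'n::finite) set" and H :: "'n coord_fun"
  assumes open_U: "open U"
    and smooth: "smooth_on (U \<times> (- {0})) (\<lambda>(x, y). H x y)"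
    and homogeneous: "\<And>x y r. x \<in> U \<Longrightarrow> r > 0 \<Longrightarrow> H x (r *\<^sub>R y) = r * H x y"
    and pos_def: "\<And>x y w. x \<in> U \<Longrightarrow> y \<noteq> 0 \<Longrightarrow> w \<noteq> 0 \<Longrightarrow>
      (\<Sum>i\<in>UNIV. \<Sum>j\<in>UNIV. fund_tensor H i j x y * w $ i * w $ j) > 0"
begin

lemma smooth_sq: "smooth_on (U \<times> (- {0})) (\<lambda>(x, y). sq H x y)"
  using smooth_on_mult[OF open_Times[OF open_U open_nonzero] smooth smooth]
  by (simp add: sq_def power2_eq_square case_prod_unfold)

lemmas smooth_deriv_y_sq = smooth_on_deriv_y[OF open_U open_nonzero smooth_sq]

lemma smooth_slice:
  "smooth_on (U \<times> (- {0})) (\<lambda>(x, y). K x y) \<Longrightarrow> x \<in> U \<Longrightarrow> smooth_on (- {0}) (K x)"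
  by (rule smooth_on_case_prod_slice[of "- {0}" U K x]) auto

lemma smooth_sq_slice: "x \<in> U \<Longrightarrow> smooth_on (- {0}) (sq H x)"
  by (rule smooth_slice[OF smooth_sq])

lemma smooth_deriv_y_slice:
  "smooth_on (- {0}) (K x) \<Longrightarrow> smooth_on (- {0}) (deriv_y i K x)"
  unfolding deriv_y_eq by (rule smooth_on_partial_deriv) auto

lemma smooth_fund_tensor: "x \<in> U \<Longrightarrow> smooth_on (- {0}) (fund_tensor H i j x)"
  unfolding fund_tensor_def
  by (intro smooth_on_mult smooth_on_const smooth_deriv_y_slice smooth_sq_slice) auto

text \<open>If g w = 0 then the quadratic form of g vanishes at w, so w = 0 by positive
  definiteness.\<close>

lemma invertible_fund_tensor:
  assumes "x \<in> U" "y \<noteq> 0"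
  shows "invertible (\<chi> k l. fund_tensor H k l x y)" (is "invertible ?g")
proof -
  have "w = 0" if "?g *v w = 0" for w
  proof (rule ccontr)
    assume "w \<noteq> 0"
    have "(\<Sum>i\<in>UNIV. \<Sum>j\<in>UNIV. fund_tensor H i j x y * w $ i * w $ j)
        = (\<Sum>i\<in>UNIV. w $ i * (?g *v w) $ i)"
      by (simp add: matrix_vector_mult_def sum_distrib_left mult_ac)
    also have "\<dots> = 0" by (simp add: that)
    finally show False using pos_def[OF assms \<open>w \<noteq> 0\<close>] by simp
  qed
  then show ?thesis
    using matrix_left_invertible_ker[of ?g] invertible_left_inverse by blast
qed

lemma smooth_fund_inverse: "x \<in> U \<Longrightarrow> smooth_on (- {0}) (fund_inverse H i j x)"
  unfolding fund_inverse_def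
  by (intro smooth_on_matrix_inv) (auto intro: smooth_fund_tensor invertible_fund_tensor)

lemma smooth_component: "smooth_on (- {0}) (\<lambda>y::real^'n. y $ k)"
  by (rule smooth_on_subset[OF smooth_on_linear]) (auto simp: bounded_linear_vec_nth)

text \<open>Smoothness in the fibre at a fixed base point is what the Berwald curvature uses. The
  mixed derivatives come from joint smoothness, which is sliced only after differentiating in
  \<open>x\<close>.\<close>

lemma smooth_spray_coeff:
  assumes "x \<in> U"
  shows "smooth_on (- {0}) (spray_coeff H i x)"
proof -
  have "smooth_on (- {0}) (deriv_x k (deriv_y l (sq H)) x)" "smooth_on (- {0}) (deriv_x l (sq H) x)"
    for k l
    using assms open_U
    by (auto intro!: smooth_slice smooth_on_deriv_x smooth_on_deriv_y smooth_sq)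
  then show ?thesis
    unfolding spray_coeff_def using assms
    by (intro smooth_on_mult smooth_on_const smooth_on_sum smooth_on_diff smooth_component
        smooth_fund_inverse) auto
qed

lemma sq_scale: "x \<in> U \<Longrightarrow> t > 0 \<Longrightarrow> sq H x (t *\<^sub>R y) = t\<^sup>2 * sq H x y"
  by (simp add: sq_def homogeneous power_mult_distrib)

lemma deriv_y_sq_scale:
  assumes "x \<in> U" "y \<noteq> 0" "t > 0"
  shows "deriv_y i (sq H) x (t *\<^sub>R y) = t * deriv_y i (sq H) x y"
  unfolding deriv_y_eq
  using partial_deriv_scale[of "- {0}" y t "sq H x" "t\<^sup>2" i] assms
    smooth_on_differentiable[OF smooth_sq_slice] sq_scale
  by (simp add: power2_eq_square)

lemma fund_tensor_scale:
  assumes "x \<in> U" "y \<noteq> 0" "t > 0"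
  shows "fund_tensor H i j x (t *\<^sub>R y) = fund_tensor H i j x y"
  unfolding fund_tensor_def deriv_y_eq[of i]
  using partial_deriv_scale[of "- {0}" y t "deriv_y j (sq H) x" t i] assms deriv_y_sq_scale
    smooth_on_differentiable[OF smooth_deriv_y_slice[of "sq H", OF smooth_sq_slice[OF assms(1)]]]
  by simp

lemma fund_inverse_scale:
  "x \<in> U \<Longrightarrow> y \<noteq> 0 \<Longrightarrow> t > 0 \<Longrightarrow> fund_inverse H i j x (t *\<^sub>R y) = fund_inverse H i j x y"
  by (simp add: fund_inverse_def fund_tensor_scale)

lemma y_lower_scale:
  "x \<in> U \<Longrightarrow> y \<noteq> 0 \<Longrightarrow> t > 0 \<Longrightarrow> y_lower H i x (t *\<^sub>R y) = t * y_lower H i x y"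
  by (simp add: y_lower_def fund_tensor_scale sum_distrib_left mult_ac)

text \<open>Euler's relation in degree 2 and in degree 1 gives g_ij y^i y^j = F^2, which turns
  positive definiteness into positivity of F^2.\<close>

lemma sq_pos:
  assumes "x \<in> U" "y \<noteq> 0"
  shows "sq H x y > 0"
proof -
  have A: "(\<Sum>j\<in>UNIV. y $ j * partial_deriv j (sq H x) y) = 2 * sq H x y"
    using euler_homogeneous[of "sq H x" y 2] smooth_on_differentiable[OF smooth_sq_slice] assms sq_scale
    by simp
  have B: "(\<Sum>i\<in>UNIV. y $ i * partial_deriv i (partial_deriv j (sq H x)) y) = partial_deriv j (sq H x) y"
    for j
    using euler_homogeneous[of "partial_deriv j (sq H x)" y 1] assms deriv_y_sq_scale
      smooth_on_differentiable[OF smooth_deriv_y_slice[of "sq H", OF smooth_sq_slice[OF assms(1)]]]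
    by (simp add: deriv_y_eq)
  \<comment> \<open>The swap lets the inner sum run over \<open>i\<close>, the index of the outer
    derivative, where \<open>B\<close> applies; \<open>A\<close> then treats the sum over
    \<open>j\<close>.\<close>
  have "(\<Sum>i\<in>UNIV. \<Sum>j\<in>UNIV. fund_tensor H i j x y * y $ i * y $ j)
      = (\<Sum>j\<in>UNIV. \<Sum>i\<in>UNIV. fund_tensor H i j x y * y $ i * y $ j)"
    by (rule sum.swap)
  also have "\<dots> = 1/2 * (\<Sum>j\<in>UNIV. y $ j * (\<Sum>i\<in>UNIV. y $ i * partial_deriv i (partial_deriv j (sq H x)) y))"
    by (simp add: fund_tensor_def deriv_y_eq sum_distrib_left mult_ac)
  also have "\<dots> = sq H x y"
    by (simp add: A B)
  finally show ?thesis using pos_def[OF assms assms(2)] by simp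
qed

end

section \<open>Product coordinates\<close>

definition left_part :: "real ^ ('m::finite + 'n::finite) \<Rightarrow> real ^ 'm" where
  "left_part w = (\<chi> i. w $ Inl i)"

definition right_part :: "real ^ ('m::finite + 'n::finite) \<Rightarrow> real ^ 'n" where
  "right_part w = (\<chi> j. w $ Inr j)"

definition join_parts :: "real ^ 'm \<Rightarrow> real ^ 'n \<Rightarrow> real ^ ('m::finite + 'n::finite)" where
  "join_parts y v = (\<chi> k. case k of Inl i \<Rightarrow> y $ i | Inr j \<Rightarrow> v $ j)"

lemma part_nth [simp]: "left_part w $ i = w $ Inl i" "right_part w $ j = w $ Inr j"
  by (simp_all add: left_part_def right_part_def)

lemma part_join [simp]: "left_part (join_parts y v) = y" "right_part (join_parts y v) = v"
  by (simp_all add: vec_eq_iff join_parts_def)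

lemma join_part [simp]: "join_parts (left_part w) (right_part w) = w"
  by (simp add: vec_eq_iff join_parts_def split: sum.split)

lemma part_line [simp]:
  "left_part (w + t *\<^sub>R axis (Inl i) 1) = left_part w + t *\<^sub>R axis i 1"
  "left_part (w + t *\<^sub>R axis (Inr j) 1) = left_part w"
  "right_part (w + t *\<^sub>R axis (Inl i) 1) = right_part w"
  "right_part (w + t *\<^sub>R axis (Inr j) 1) = right_part w + t *\<^sub>R axis j 1"
  by (simp_all add: vec_eq_iff axis_def)

lemma bounded_linear_left_part: "bounded_linear left_part"
  and bounded_linear_right_part: "bounded_linear right_part"
  by (auto intro!: linearI simp: vec_eq_iff simp flip: linear_conv_bounded_linear)

lemma open_parts:
  assumes "open S" "open T"
  shows "open {w. left_part w \<in> S \<and> right_part w \<in> T}"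
proof -
  have "open (left_part -` S \<inter> right_part -` T)"
    using assms bounded_linear_left_part bounded_linear_right_part
    by (intro open_Int open_vimage linear_continuous_on) auto
  then show ?thesis by (simp add: vimage_def Int_def)
qed

lemma sum_UNIV_Plus:
  "(\<Sum>k\<in>UNIV. f k) = (\<Sum>i\<in>UNIV. f (Inl i)) + (\<Sum>j\<in>UNIV. f (Inr j))"
  for f :: "'m::finite + 'n::finite \<Rightarrow> real"
  by (simp add: UNIV_Plus_UNIV[symmetric] sum.Plus del: UNIV_Plus_UNIV)

text \<open>Two product terms are enough for the square of the metric and for each spray
  coefficient. The form is stable under partial derivatives, each acting on the factors of one
  block. The sets are parameters because it is used both on vectors, off zero, and on base points,
  over the chart images.\<close>

definition separated ::
    "(real ^ 'm) set \<Rightarrow> (real ^ 'n) set \<Rightarrow> (real ^ ('m::finite + 'n::finite) \<Rightarrow> real) \<Rightarrow>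
     (real ^ 'm \<Rightarrow> real) \<Rightarrow> (real ^ 'n \<Rightarrow> real) \<Rightarrow>
     (real ^ 'm \<Rightarrow> real) \<Rightarrow> (real ^ 'n \<Rightarrow> real) \<Rightarrow> bool" where
  "separated S T K p q p' q' \<longleftrightarrow> (\<forall>w. left_part w \<in> S \<longrightarrow> right_part w \<in> T \<longrightarrow>
     K w = p (left_part w) * q (right_part w) + p' (left_part w) * q' (right_part w))"

lemma separatedD:
  "separated S T K p q p' q' \<Longrightarrow> left_part w \<in> S \<Longrightarrow> right_part w \<in> T \<Longrightarrow>
    K w = p (left_part w) * q (right_part w) + p' (left_part w) * q' (right_part w)"
  by (simp add: separated_def)

lemma separated_Inl:
  assumes "open S" "open T" "smooth_on S p" "smooth_on S p'" "separated S T K p q p' q'"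
  shows "separated S T (partial_deriv (Inl i) K) (partial_deriv i p) q (partial_deriv i p') q'"
  unfolding separated_def
proof (intro allI impI)
  fix w :: "real ^ ('a + 'b)"
  assume w: "left_part w \<in> S" "right_part w \<in> T"
  have "partial_deriv (Inl i) K w = partial_deriv (Inl i)
      (\<lambda>w. p (left_part w) * q (right_part w) + p' (left_part w) * q' (right_part w)) w"
    using assms(5) w by (intro partial_deriv_cong[OF open_parts[OF assms(1,2)]])
      (auto simp: separated_def)
  also have "\<dots> = partial_deriv i p (left_part w) * q (right_part w)
      + partial_deriv i p' (left_part w) * q' (right_part w)"
    \<comment> \<open>By \<open>part_line\<close> the right part does not move along this line, so
      the right factors are constants.\<close>
    by (intro partial_derivI, simp)
      (intro DERIV_add DERIV_cmult_right partial_deriv_line smooth_on_differentiable[OF _ w(1)] assms)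
  finally show "partial_deriv (Inl i) K w = \<dots>" .
qed

lemma separated_Inr:
  assumes "open S" "open T" "smooth_on T q" "smooth_on T q'" "separated S T K p q p' q'"
  shows "separated S T (partial_deriv (Inr i) K) p (partial_deriv i q) p' (partial_deriv i q')"
  unfolding separated_def
proof (intro allI impI)
  fix w :: "real ^ ('a + 'b)"
  assume w: "left_part w \<in> S" "right_part w \<in> T"
  have "partial_deriv (Inr i) K w = partial_deriv (Inr i)
      (\<lambda>w. p (left_part w) * q (right_part w) + p' (left_part w) * q' (right_part w)) w"
    using assms(5) w by (intro partial_deriv_cong[OF open_parts[OF assms(1,2)]])
      (auto simp: separated_def)
  also have "\<dots> = p (left_part w) * partial_deriv i q (right_part w)
      + p' (left_part w) * partial_deriv i q' (right_part w)"
    by (intro partial_derivI, simp)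
      (intro DERIV_add DERIV_cmult partial_deriv_line smooth_on_differentiable[OF _ w(2)] assms)
  finally show "partial_deriv (Inr i) K w = \<dots>" .
qed

lemma partial_deriv_scale_nonzero:
  assumes "smooth_on (- {0}) f" "t > 0" "\<And>y. y \<noteq> 0 \<Longrightarrow> f (t *\<^sub>R y) = c * f y" "y \<noteq> 0"
  shows "partial_deriv i f (t *\<^sub>R y) = c / t * partial_deriv i f y"
  using assms by (intro partial_deriv_scale[of "- {0}"] smooth_on_differentiable[OF assms(1)]) auto

section \<open>Laurent polynomials in the scaling parameter\<close>

text \<open>These exponents are the union of those met in the two cases: 0 and 2 when the second
  vector is scaled, -1, 0 and 1 when the first is. Only t > 0 occurs because homogeneity is positive
  homogeneity.\<close>

definition laurent :: "(real \<Rightarrow> real) \<Rightarrow> bool" where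
  "laurent f \<longleftrightarrow> (\<exists>a b c d. \<forall>t>0. f t = a / t + b + c * t + d * t\<^sup>2)"

lemma laurentI: "(\<And>t. t > 0 \<Longrightarrow> f t = a / t + b + c * t + d * t\<^sup>2) \<Longrightarrow> laurent f"
  unfolding laurent_def by blast

lemma laurent_cong: "laurent f \<Longrightarrow> (\<And>t. t > 0 \<Longrightarrow> g t = f t) \<Longrightarrow> laurent g"
  unfolding laurent_def by auto

lemma laurent_add: "laurent f \<Longrightarrow> laurent g \<Longrightarrow> laurent (\<lambda>t. f t + g t)"
  unfolding laurent_def
proof (elim exE)
  fix a b c d a' b' c' d'
  assume "\<forall>t>0. f t = a / t + b + c * t + d * t\<^sup>2" "\<forall>t>0. g t = a' / t + b' + c' * t + d' * t\<^sup>2"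
  then have "\<forall>t>0. f t + g t = (a + a') / t + (b + b') + (c + c') * t + (d + d') * t\<^sup>2"
    by (simp add: algebra_simps add_divide_distrib)
  then show "\<exists>a b c d. \<forall>t>0. f t + g t = a / t + b + c * t + d * t\<^sup>2" by blast
qed

lemma laurent_cmult: "laurent f \<Longrightarrow> laurent (\<lambda>t. k * f t)"
  unfolding laurent_def
proof (elim exE)
  fix a b c d
  assume "\<forall>t>0. f t = a / t + b + c * t + d * t\<^sup>2"
  then have "\<forall>t>0. k * f t = (k * a) / t + k * b + (k * c) * t + (k * d) * t\<^sup>2"
    by (simp add: algebra_simps)
  then show "\<exists>a b c d. \<forall>t>0. k * f t = a / t + b + c * t + d * t\<^sup>2" by blast
qed

lemma laurent_sum:
  assumes "\<And>i. i \<in> I \<Longrightarrow> laurent (f i)"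
  shows "laurent (\<lambda>t. \<Sum>i\<in>I. f i t)"
proof -
  have "laurent (\<lambda>t. 0)" by (rule laurentI[of _ 0 0 0 0]) simp
  with assms show ?thesis
    by (induction I rule: infinite_finite_induct) (auto intro: laurent_add)
qed

text \<open>The extreme coefficients force a = d = 0. What remains is (b + c t)^2, whose mixed
  coefficient must vanish, while b^2 and c^2 would both be nonzero multiples of
  \<open>m\<close>.\<close>

lemma laurent_sqrt_quadratic:
  assumes "laurent f" "\<alpha> > 0" "\<beta> > 0"
    and "\<And>t. t > 0 \<Longrightarrow> (f t)\<^sup>2 = m * (\<alpha> + \<beta> * t\<^sup>2)"
  shows "m = 0"
proof (rule ccontr)
  assume "m \<noteq> 0"
  obtain a b c d where f: "\<And>t. t > 0 \<Longrightarrow> f t = a / t + b + c * t + d * t\<^sup>2"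
    using assms(1) by (auto simp: laurent_def)
  \<comment> \<open>\<open>P\<close> is t^2 times the difference of the two sides; the factor t^2
    clears the pole of the square.\<close>
  define P where "P = [:a\<^sup>2, 2*a*b, 2*a*c + b\<^sup>2 - m*\<alpha>, 2*a*d + 2*b*c, c\<^sup>2 + 2*b*d - m*\<beta>, 2*c*d, d\<^sup>2:]"
  have "poly P t = 0" if "t > 0" for t
  proof -
    have "poly P t = (t * (a / t + b + c * t + d * t\<^sup>2))\<^sup>2 - t\<^sup>2 * (m * (\<alpha> + \<beta> * t\<^sup>2))"
      using that by (simp add: P_def power2_eq_square distrib_left) (simp add: algebra_simps)
    also have "\<dots> = 0"
      using assms(4)[OF that] f[OF that] by (simp add: power_mult_distrib)
    finally show ?thesis .
  qed
  then have "{0<..} \<subseteq> {t. poly P t = 0}" by auto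
  then have "P = 0"
    using poly_roots_finite[of P] infinite_Ioi[of "0::real"] finite_subset by blast
  \<comment> \<open>The constant and the top coefficient are squares, so a = d = 0, and the other
    coefficients then simplify.\<close>
  then have "a = 0" "d = 0" "b\<^sup>2 = m * \<alpha>" "b * c = 0" "c\<^sup>2 = m * \<beta>"
    by (auto simp: P_def)
  with assms(2,3) \<open>m \<noteq> 0\<close> show False by auto
qed

section \<open>Local warped products\<close>

text \<open>The warped metric \<open>H\<close> in a product chart enters through its square, with
  \<phi> the square of the warping function. The factor metrics bring their own smoothness and
  positivity.\<close>

locale local_warped =
  M: local_finsler U H1 + N: local_finsler V H2
  for U :: "(real ^ 'm::finite) set" and H1 :: "'m coord_fun"
    and V :: "(real ^ 'n::finite) set" and H2 :: "'n coord_fun" +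
  fixes \<phi> :: "real ^ 'm \<Rightarrow> real" and H :: "('m + 'n) coord_fun"
  assumes smooth_\<phi>: "smooth_on U \<phi>"
    and \<phi>_pos: "\<And>x. x \<in> U \<Longrightarrow> \<phi> x > 0"
    and sq_eq: "\<And>z w. left_part z \<in> U \<Longrightarrow> right_part z \<in> V \<Longrightarrow>
      sq H z w = sq H1 (left_part z) (left_part w)
        + \<phi> (left_part z) * sq H2 (right_part z) (right_part w)"
begin

lemmas separated_intros = separated_Inl separated_Inr smooth_on_partial_deriv smooth_on_const
  open_nonzero

lemma separated_sq:
  "left_part z \<in> U \<Longrightarrow> right_part z \<in> V \<Longrightarrow>
   separated (- {0}) (- {0}) (sq H z) (sq H1 (left_part z)) (\<lambda>_. 1)
     (\<lambda>_. \<phi> (left_part z)) (sq H2 (right_part z))"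
  by (simp add: separated_def sq_eq)

section \<open>Fundamental tensor of the warped product\<close>

context
  fixes z w :: "real ^ ('m + 'n)"
  assumes z: "left_part z \<in> U" "right_part z \<in> V"
    and w: "left_part w \<noteq> 0" "right_part w \<noteq> 0"
begin

lemma parts_nonzero: "left_part w \<in> - {0}" "right_part w \<in> - {0}"
  using w by auto

lemma deriv_y_sq_warped:
  "deriv_y (Inl i) (sq H) z w = deriv_y i (sq H1) (left_part z) (left_part w)"
  "deriv_y (Inr a) (sq H) z w =
     \<phi> (left_part z) * deriv_y a (sq H2) (right_part z) (right_part w)"
proof -
  show "deriv_y (Inl i) (sq H) z w = deriv_y i (sq H1) (left_part z) (left_part w)"
    using separatedD[OF separated_Inl[OF _ _ _ _ separated_sq[OF z], of i] parts_nonzero]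
      M.smooth_sq_slice[OF z(1)] by (simp add: deriv_y_eq smooth_on_const)
  show "deriv_y (Inr a) (sq H) z w =
     \<phi> (left_part z) * deriv_y a (sq H2) (right_part z) (right_part w)"
    using separatedD[OF separated_Inr[OF _ _ _ _ separated_sq[OF z], of a] parts_nonzero]
      N.smooth_sq_slice[OF z(2)] by (simp add: deriv_y_eq smooth_on_const)
qed

text \<open>Each summand of F^2 is constant in one of the two vectors, so a mixed second derivative
  kills both.\<close>

lemma fund_tensor_warped:
  "fund_tensor H (Inl i) (Inl j) z w = fund_tensor H1 i j (left_part z) (left_part w)"
  "fund_tensor H (Inl i) (Inr b) z w = 0"
  "fund_tensor H (Inr a) (Inl j) z w = 0"
  "fund_tensor H (Inr a) (Inr b) z w =
     \<phi> (left_part z) * fund_tensor H2 a b (right_part z) (right_part w)"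
proof -
  note sep = separated_sq[OF z]
  note sm = M.smooth_sq_slice[OF z(1)] N.smooth_sq_slice[OF z(2)]
  note rules = separated_intros sep sm
  have "separated (- {0}) (- {0}) (partial_deriv (Inl i) (partial_deriv (Inl j) (sq H z)))
     (partial_deriv i (partial_deriv j (sq H1 (left_part z)))) (\<lambda>_. 1)
     (partial_deriv i (partial_deriv j (\<lambda>_. \<phi> (left_part z)))) (sq H2 (right_part z))"
    by (intro rules)
  from separatedD[OF this parts_nonzero]
  show "fund_tensor H (Inl i) (Inl j) z w = fund_tensor H1 i j (left_part z) (left_part w)"
    by (simp add: fund_tensor_def deriv_y_eq)
  have "separated (- {0}) (- {0}) (partial_deriv (Inl i) (partial_deriv (Inr b) (sq H z)))
     (partial_deriv i (sq H1 (left_part z))) (partial_deriv b (\<lambda>_. 1))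
     (partial_deriv i (\<lambda>_. \<phi> (left_part z))) (partial_deriv b (sq H2 (right_part z)))"
    by (intro rules)
  from separatedD[OF this parts_nonzero] show "fund_tensor H (Inl i) (Inr b) z w = 0"
    by (simp add: fund_tensor_def deriv_y_eq)
  have "separated (- {0}) (- {0}) (partial_deriv (Inr a) (partial_deriv (Inl j) (sq H z)))
     (partial_deriv j (sq H1 (left_part z))) (partial_deriv a (\<lambda>_. 1))
     (partial_deriv j (\<lambda>_. \<phi> (left_part z))) (partial_deriv a (sq H2 (right_part z)))"
    by (intro rules)
  from separatedD[OF this parts_nonzero] show "fund_tensor H (Inr a) (Inl j) z w = 0"
    by (simp add: fund_tensor_def deriv_y_eq)
  have "separated (- {0}) (- {0}) (partial_deriv (Inr a) (partial_deriv (Inr b) (sq H z)))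
     (sq H1 (left_part z)) (partial_deriv a (partial_deriv b (\<lambda>_. 1)))
     (\<lambda>_. \<phi> (left_part z)) (partial_deriv a (partial_deriv b (sq H2 (right_part z))))"
    by (intro rules)
  from separatedD[OF this parts_nonzero] show "fund_tensor H (Inr a) (Inr b) z w =
     \<phi> (left_part z) * fund_tensor H2 a b (right_part z) (right_part w)"
    by (simp add: fund_tensor_def deriv_y_eq)
qed

lemma y_lower_warped:
  "y_lower H (Inl i) z w = y_lower H1 i (left_part z) (left_part w)"
  "y_lower H (Inr a) z w = \<phi> (left_part z) * y_lower H2 a (right_part z) (right_part w)"
  by (simp_all add: y_lower_def sum_UNIV_Plus fund_tensor_warped sum_distrib_left mult.assoc)

lemma fund_inverse_warped:
  "fund_inverse H (Inl i) (Inl j) z w = fund_inverse H1 i j (left_part z) (left_part w)"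
  "fund_inverse H (Inl i) (Inr b) z w = 0"
  "fund_inverse H (Inr a) (Inl j) z w = 0"
  "fund_inverse H (Inr a) (Inr b) z w =
     fund_inverse H2 a b (right_part z) (right_part w) / \<phi> (left_part z)"
proof -
  let ?g = "\<chi> k l. fund_tensor H k l z w"
  let ?g1 = "\<chi> k l. fund_tensor H1 k l (left_part z) (left_part w)"
  let ?g2 = "\<chi> k l. fund_tensor H2 k l (right_part z) (right_part w)"
  \<comment> \<open>The candidate inverse is block diagonal; its second block is divided by \<phi>
    because that block of the fundamental tensor carries the factor \<phi>.\<close>
  define B where "B = (\<chi> k l. case k of
      Inl i \<Rightarrow> (case l of Inl j \<Rightarrow> matrix_inv ?g1 $ i $ j | Inr b \<Rightarrow> 0)
    | Inr a \<Rightarrow> (case l of Inl j \<Rightarrow> 0 | Inr b \<Rightarrow> matrix_inv ?g2 $ a $ b / \<phi> (left_part z)))"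
  have \<phi>: "\<phi> (left_part z) \<noteq> 0" using \<phi>_pos[OF z(1)] by simp
  have 1: "(\<Sum>k\<in>UNIV. fund_tensor H1 i k (left_part z) (left_part w) * matrix_inv ?g1 $ k $ j)
      = (if i = j then 1 else 0)" for i j
  proof -
    have "(?g1 ** matrix_inv ?g1) $ i $ j = mat 1 $ i $ j"
      using matrix_inv_mult[OF M.invertible_fund_tensor[OF z(1) w(1)]] by simp
    then show ?thesis by (simp add: matrix_matrix_mult_def mat_def)
  qed
  have 2: "(\<Sum>k\<in>UNIV. fund_tensor H2 i k (right_part z) (right_part w) * matrix_inv ?g2 $ k $ j)
      = (if i = j then 1 else 0)" for i j
  proof -
    have "(?g2 ** matrix_inv ?g2) $ i $ j = mat 1 $ i $ j"
      using matrix_inv_mult[OF N.invertible_fund_tensor[OF z(2) w(2)]] by simp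
    then show ?thesis by (simp add: matrix_matrix_mult_def mat_def)
  qed
  have "(?g ** B) $ k $ l = mat 1 $ k $ l" for k l
    by (cases k; cases l) (simp_all add: matrix_matrix_mult_def mat_def B_def sum_UNIV_Plus
        fund_tensor_warped 1 2 \<phi>)
  then have "?g ** B = mat 1" by (simp add: vec_eq_iff)
  then have "matrix_inv ?g = B" by (rule matrix_inv_eqI)
  then show
    "fund_inverse H (Inl i) (Inl j) z w = fund_inverse H1 i j (left_part z) (left_part w)"
    "fund_inverse H (Inl i) (Inr b) z w = 0"
    "fund_inverse H (Inr a) (Inl j) z w = 0"
    "fund_inverse H (Inr a) (Inr b) z w =
       fund_inverse H2 a b (right_part z) (right_part w) / \<phi> (left_part z)"
    by (simp_all add: fund_inverse_def B_def)
qed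

end

text \<open>Minus a quarter of the gradient of \<phi> with respect to the fundamental tensor at y,
  hence of degree 0 in y. It is the coefficient of F_2^2 in the spray.\<close>

definition warp_grad :: "real ^ 'm \<Rightarrow> 'm \<Rightarrow> real ^ 'm \<Rightarrow> real" where
  "warp_grad x i y = - 1/4 * (\<Sum>l\<in>UNIV. fund_inverse H1 i l x y * partial_deriv l \<phi> x)"

text \<open>The derivative of log \<phi> in the direction y, linear in y.\<close>

definition warp_rate :: "real ^ 'm \<Rightarrow> real ^ 'm \<Rightarrow> real" where
  "warp_rate x y = (\<Sum>k\<in>UNIV. partial_deriv k \<phi> x * y $ k) / \<phi> x"

text \<open>By homogeneity this is \<open>v$a / 2\<close>, but only its smoothness and degree matter.\<close>

definition fibre_radial :: "real ^ 'n \<Rightarrow> 'n \<Rightarrow> real ^ 'n \<Rightarrow> real" where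
  "fibre_radial u a v = 1/4 * (\<Sum>b\<in>UNIV. fund_inverse H2 a b u v * deriv_y b (sq H2) u v)"

section \<open>Spray coefficients, mean Cartan torsion and mean Landsberg curvature of the warped
  product\<close>

context
  fixes z w :: "real ^ ('m + 'n)"
  assumes z: "left_part z \<in> U" "right_part z \<in> V"
    and w: "left_part w \<noteq> 0" "right_part w \<noteq> 0"
begin

lemma smooth_base:
  "smooth_on U (\<lambda>x. sq H1 x (left_part w))"
  "smooth_on U (\<lambda>x. deriv_y i (sq H1) x (left_part w))"
  "smooth_on V (\<lambda>u. sq H2 u (right_part w))"
  "smooth_on V (\<lambda>u. deriv_y a (sq H2) u (right_part w))"
  using w smooth_on_case_prod_slice_fst[OF M.open_U M.smooth_sq]
    smooth_on_case_prod_slice_fst[OF M.open_U M.smooth_deriv_y_sq]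
    smooth_on_case_prod_slice_fst[OF N.open_U N.smooth_sq]
    smooth_on_case_prod_slice_fst[OF N.open_U N.smooth_deriv_y_sq]
  by auto

lemmas base_intros = separated_Inl separated_Inr smooth_on_const smooth_base smooth_\<phi>
  M.open_U N.open_U

lemma deriv_x_sq_warped:
  "deriv_x (Inl k) (sq H) z w = deriv_x k (sq H1) (left_part z) (left_part w)
     + partial_deriv k \<phi> (left_part z) * sq H2 (right_part z) (right_part w)"
  "deriv_x (Inr c) (sq H) z w = \<phi> (left_part z) * deriv_x c (sq H2) (right_part z) (right_part w)"
proof -
  \<comment> \<open>Now the vectors are frozen and the base point varies, so \<phi> changes from a
    constant into a left factor.\<close>
  have sep: "separated U V (\<lambda>z. sq H z w) (\<lambda>x. sq H1 x (left_part w)) (\<lambda>_. 1)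
      \<phi> (\<lambda>u. sq H2 u (right_part w))"
    by (simp add: separated_def sq_eq)
  note rules = base_intros sep
  have "separated U V (partial_deriv (Inl k) (\<lambda>z. sq H z w))
      (partial_deriv k (\<lambda>x. sq H1 x (left_part w))) (\<lambda>_. 1)
      (partial_deriv k \<phi>) (\<lambda>u. sq H2 u (right_part w))"
    by (intro rules)
  from separatedD[OF this z]
  show "deriv_x (Inl k) (sq H) z w = deriv_x k (sq H1) (left_part z) (left_part w)
     + partial_deriv k \<phi> (left_part z) * sq H2 (right_part z) (right_part w)"
    by (simp add: deriv_x_eq)
  have "separated U V (partial_deriv (Inr c) (\<lambda>z. sq H z w))
      (\<lambda>x. sq H1 x (left_part w)) (partial_deriv c (\<lambda>_. 1))
      \<phi> (partial_deriv c (\<lambda>u. sq H2 u (right_part w)))"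
    by (intro rules)
  from separatedD[OF this z]
  show "deriv_x (Inr c) (sq H) z w =
      \<phi> (left_part z) * deriv_x c (sq H2) (right_part z) (right_part w)"
    by (simp add: deriv_x_eq)
qed

lemma deriv_x_deriv_y_sq_warped:
  "deriv_x (Inl k) (deriv_y (Inl l) (sq H)) z w =
     deriv_x k (deriv_y l (sq H1)) (left_part z) (left_part w)"
  "deriv_x (Inr c) (deriv_y (Inl l) (sq H)) z w = 0"
  "deriv_x (Inl k) (deriv_y (Inr b) (sq H)) z w =
     partial_deriv k \<phi> (left_part z) * deriv_y b (sq H2) (right_part z) (right_part w)"
  "deriv_x (Inr c) (deriv_y (Inr b) (sq H)) z w =
     \<phi> (left_part z) * deriv_x c (deriv_y b (sq H2)) (right_part z) (right_part w)"
proof -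
  have sep_l: "separated U V (\<lambda>z. deriv_y (Inl l) (sq H) z w)
      (\<lambda>x. deriv_y l (sq H1) x (left_part w)) (\<lambda>_. 1) (\<lambda>_. 0) (\<lambda>_. 0)"
    using w by (simp add: separated_def deriv_y_sq_warped)
  have sep_b: "separated U V (\<lambda>z. deriv_y (Inr b) (sq H) z w)
      (\<lambda>_. 0) (\<lambda>_. 0) \<phi> (\<lambda>u. deriv_y b (sq H2) u (right_part w))"
    using w by (simp add: separated_def deriv_y_sq_warped)
  show "deriv_x (Inl k) (deriv_y (Inl l) (sq H)) z w =
      deriv_x k (deriv_y l (sq H1)) (left_part z) (left_part w)"
    using separatedD[OF separated_Inl[OF _ _ _ _ sep_l, of k] z]
    by (simp add: deriv_x_eq base_intros)
  show "deriv_x (Inr c) (deriv_y (Inl l) (sq H)) z w = 0"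
    using separatedD[OF separated_Inr[OF _ _ _ _ sep_l, of c] z]
    by (simp add: deriv_x_eq base_intros)
  show "deriv_x (Inl k) (deriv_y (Inr b) (sq H)) z w =
     partial_deriv k \<phi> (left_part z) * deriv_y b (sq H2) (right_part z) (right_part w)"
    using separatedD[OF separated_Inl[OF _ _ _ _ sep_b, of k] z]
    by (simp add: deriv_x_eq base_intros)
  show "deriv_x (Inr c) (deriv_y (Inr b) (sq H)) z w =
     \<phi> (left_part z) * deriv_x c (deriv_y b (sq H2)) (right_part z) (right_part w)"
    using separatedD[OF separated_Inr[OF _ _ _ _ sep_b, of c] z]
    by (simp add: deriv_x_eq base_intros)
qed

text \<open>In the first block F_2^2 enters only through the x-derivative of \<phi>. In the second
  block \<phi> cancels against 1/\<phi> from the inverse, and the new term comes from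
  differentiating \<phi> F_2^2 once in the base point x and once in the second vector.\<close>

lemma spray_coeff_warped:
  "spray_coeff H (Inl i) z w = spray_coeff H1 i (left_part z) (left_part w)
     + warp_grad (left_part z) i (left_part w) * sq H2 (right_part z) (right_part w)"
  "spray_coeff H (Inr a) z w = spray_coeff H2 a (right_part z) (right_part w)
     + warp_rate (left_part z) (left_part w) * fibre_radial (right_part z) a (right_part w)"
proof -
  note warped = sum_UNIV_Plus fund_inverse_warped[OF z w] deriv_x_sq_warped
    deriv_x_deriv_y_sq_warped
  let ?x = "left_part z" and ?u = "right_part z" and ?y = "left_part w" and ?v = "right_part w"
  show "spray_coeff H (Inl i) z w = spray_coeff H1 i ?x ?y + warp_grad ?x i ?y * sq H2 ?u ?v"
    by (simp add: spray_coeff_def warp_grad_def warped sum_distrib_left sum_distrib_right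
        sum.distrib[symmetric] sum_subtractf[symmetric] add_divide_distrib algebra_simps)
  have \<phi>: "\<phi> ?x \<noteq> 0" using \<phi>_pos[OF z(1)] by simp
  have rate: "(\<Sum>k\<in>UNIV. partial_deriv k \<phi> ?x * deriv_y b (sq H2) ?u ?v * w $ Inl k)
      = \<phi> ?x * warp_rate ?x ?y * deriv_y b (sq H2) ?u ?v" for b
    using \<phi> by (simp add: warp_rate_def) (simp add: sum_distrib_left mult_ac)
  have fibre: "(\<Sum>c\<in>UNIV. \<phi> ?x * deriv_x c (deriv_y b (sq H2)) ?u ?v * w $ Inr c)
      = \<phi> ?x * (\<Sum>c\<in>UNIV. deriv_x c (deriv_y b (sq H2)) ?u ?v * ?v $ c)" for b
    by (simp add: sum_distrib_left mult_ac)
  have "spray_coeff H (Inr a) z w = 1/4 * (\<Sum>b\<in>UNIV. fund_inverse H2 a b ?u ?v / \<phi> ?x *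
      (\<phi> ?x * warp_rate ?x ?y * deriv_y b (sq H2) ?u ?v
       + \<phi> ?x * (\<Sum>c\<in>UNIV. deriv_x c (deriv_y b (sq H2)) ?u ?v * ?v $ c)
       - \<phi> ?x * deriv_x b (sq H2) ?u ?v))"
    unfolding spray_coeff_def warped rate fibre by simp
  also have "\<dots> = 1/4 * (\<Sum>b\<in>UNIV. fund_inverse H2 a b ?u ?v *
      ((\<Sum>c\<in>UNIV. deriv_x c (deriv_y b (sq H2)) ?u ?v * ?v $ c) - deriv_x b (sq H2) ?u ?v)
      + warp_rate ?x ?y * (fund_inverse H2 a b ?u ?v * deriv_y b (sq H2) ?u ?v))"
    using \<phi> by (intro arg_cong2[where f = times] refl sum.cong) (simp add: field_simps)
  also have "\<dots> = spray_coeff H2 a ?u ?v + warp_rate ?x ?y * fibre_radial ?u a ?v"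
    by (simp add: spray_coeff_def fibre_radial_def sum.distrib sum_distrib_left[symmetric] distrib_left)
  finally show "spray_coeff H (Inr a) z w = \<dots>" .
qed

text \<open>Torsion components that survive the trace have all indices in one block, and in the
  second block the factor \<phi> cancels against 1/\<phi>. Hence each component ignores the vector
  of the other block, which is what permits scaling that vector.\<close>

lemma mean_cartan_torsion_warped:
  "mean_cartan_torsion H (Inl i) z w = mean_cartan_torsion H1 i (left_part z) (left_part w)"
  "mean_cartan_torsion H (Inr a) z w = mean_cartan_torsion H2 a (right_part z) (right_part w)"
proof -
  have w': "left_part w \<in> - {0}" "right_part w \<in> - {0}" using w by auto
  note rules = separated_Inl separated_Inr smooth_on_const open_nonzero
    M.smooth_fund_tensor[OF z(1)] N.smooth_fund_tensor[OF z(2)]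
  have LL: "separated (- {0}) (- {0}) (fund_tensor H (Inl i) (Inl j) z)
      (fund_tensor H1 i j (left_part z)) (\<lambda>_. 1) (\<lambda>_. 0) (\<lambda>_. 0)" for i j
    by (simp add: separated_def fund_tensor_warped z)
  have LR: "separated (- {0}) (- {0}) (fund_tensor H (Inl i) (Inr b) z)
      (\<lambda>_. 0) (\<lambda>_. 0) (\<lambda>_. 0) (\<lambda>_. 0)" for i b
    by (simp add: separated_def fund_tensor_warped z)
  have RL: "separated (- {0}) (- {0}) (fund_tensor H (Inr a) (Inl j) z)
      (\<lambda>_. 0) (\<lambda>_. 0) (\<lambda>_. 0) (\<lambda>_. 0)" for a j
    by (simp add: separated_def fund_tensor_warped z)
  have RR: "separated (- {0}) (- {0}) (fund_tensor H (Inr a) (Inr b) z)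
      (\<lambda>_. 0) (\<lambda>_. 0) (\<lambda>_. \<phi> (left_part z)) (fund_tensor H2 a b (right_part z))" for a b
    by (simp add: separated_def fund_tensor_warped z)
  have "cartan_torsion H (Inl i) (Inl j) (Inl k) z w = cartan_torsion H1 i j k (left_part z) (left_part w)"
    for i j k
    using separatedD[OF separated_Inl[OF _ _ _ _ LL[of i j], of k] w']
    by (simp add: cartan_torsion_def deriv_y_eq rules)
  moreover have "cartan_torsion H (Inl i) (Inr b) (Inr c) z w = 0" for i b c
    using separatedD[OF separated_Inr[OF _ _ _ _ LR[of i b], of c] w']
    by (simp add: cartan_torsion_def deriv_y_eq rules)
  moreover have "cartan_torsion H (Inr a) (Inl j) (Inl k) z w = 0" for a j k
    using separatedD[OF separated_Inl[OF _ _ _ _ RL[of a j], of k] w']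
    by (simp add: cartan_torsion_def deriv_y_eq rules)
  moreover have "cartan_torsion H (Inr a) (Inr b) (Inr c) z w =
      \<phi> (left_part z) * cartan_torsion H2 a b c (right_part z) (right_part w)" for a b c
    using separatedD[OF separated_Inr[OF _ _ _ _ RR[of a b], of c] w']
    by (simp add: cartan_torsion_def deriv_y_eq rules)
  moreover have "\<phi> (left_part z) \<noteq> 0" using \<phi>_pos[OF z(1)] by simp
  ultimately show
    "mean_cartan_torsion H (Inl i) z w = mean_cartan_torsion H1 i (left_part z) (left_part w)"
    "mean_cartan_torsion H (Inr a) z w = mean_cartan_torsion H2 a (right_part z) (right_part w)"
    by (simp_all add: mean_cartan_torsion_def sum_UNIV_Plus fund_inverse_warped[OF z w])
qed

text \<open>The inverse is block diagonal, so only pairs of traced indices from the same block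
  contribute.\<close>

lemma mean_landsberg_warped:
  "mean_landsberg H \<alpha> z w =
     (\<Sum>j\<in>UNIV. \<Sum>k\<in>UNIV. fund_inverse H1 j k (left_part z) (left_part w) *
        landsberg H \<alpha> (Inl j) (Inl k) z w)
   + 1 / \<phi> (left_part z) * (\<Sum>b\<in>UNIV. \<Sum>c\<in>UNIV.
        fund_inverse H2 b c (right_part z) (right_part w) * landsberg H \<alpha> (Inr b) (Inr c) z w)"
  by (simp add: mean_landsberg_def sum_UNIV_Plus fund_inverse_warped[OF z w] sum_distrib_left
      sum_divide_distrib)

end

section \<open>Behaviour of the curvatures when one of the two vectors is scaled\<close>

context
  fixes x :: "real ^ 'm" and u :: "real ^ 'n" and z :: "real ^ ('m + 'n)"
    and y :: "real ^ 'm" and v :: "real ^ 'n"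
  assumes x: "x \<in> U" and u: "u \<in> V" and z_def: "z = join_parts x u"
    and y: "y \<noteq> 0" and v: "v \<noteq> 0"
begin

lemma base_in_domain: "left_part z \<in> U" "right_part z \<in> V"
  using x u by (simp_all add: z_def)

lemma base_parts: "left_part z = x" "right_part z = u"
  by (simp_all add: z_def)

lemma smooth_coefficients:
  "smooth_on (- {0}) (warp_grad x i)"
  "smooth_on (- {0}) (warp_rate x)"
  "smooth_on (- {0}) (fibre_radial u a)"
proof -
  show "smooth_on (- {0}) (warp_grad x i)"
    unfolding warp_grad_def
    by (intro smooth_on_mult smooth_on_sum smooth_on_const M.smooth_fund_inverse x open_nonzero)
  show "smooth_on (- {0}) (warp_rate x)"
    unfolding warp_rate_def divide_inverse
    by (intro smooth_on_mult smooth_on_sum smooth_on_const M.smooth_component open_nonzero)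
  show "smooth_on (- {0}) (fibre_radial u a)"
    unfolding fibre_radial_def
    by (intro smooth_on_mult smooth_on_sum smooth_on_const N.smooth_fund_inverse u open_nonzero
        N.smooth_deriv_y_slice N.smooth_sq_slice)
qed

lemmas smooth_intros = smooth_coefficients M.smooth_spray_coeff[OF x] N.smooth_spray_coeff[OF u]
  N.smooth_sq_slice[OF u] smooth_on_const smooth_on_partial_deriv open_nonzero

lemma separated_spray:
  "separated (- {0}) (- {0}) (spray_coeff H (Inl l) z)
     (spray_coeff H1 l x) (\<lambda>_. 1) (warp_grad x l) (sq H2 u)"
  "separated (- {0}) (- {0}) (spray_coeff H (Inr d) z)
     (\<lambda>_. 1) (spray_coeff H2 d u) (warp_rate x) (fibre_radial u d)"
  using spray_coeff_warped[OF base_in_domain] by (auto simp: separated_def z_def)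

text \<open>The degrees are 0 and 1 for the two warping factors in y, and 2 and 1 for F_2^2 and the
  radial factor in v. Two derivatives lower each of them by 2.\<close>

lemma coefficient_scale:
  fixes t :: real
  assumes t: "t > 0"
  shows "warp_grad x l (t *\<^sub>R y) = warp_grad x l y"
    and "partial_deriv j (partial_deriv k (warp_grad x l)) (t *\<^sub>R y)
      = partial_deriv j (partial_deriv k (warp_grad x l)) y / t\<^sup>2"
    and "warp_rate x (t *\<^sub>R y) = t * warp_rate x y"
    and "partial_deriv j (partial_deriv k (warp_rate x)) (t *\<^sub>R y)
      = partial_deriv j (partial_deriv k (warp_rate x)) y / t"
    and "sq H2 u (t *\<^sub>R v) = t\<^sup>2 * sq H2 u v"
    and "partial_deriv a (partial_deriv b (sq H2 u)) (t *\<^sub>R v)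
      = partial_deriv a (partial_deriv b (sq H2 u)) v"
    and "fibre_radial u d (t *\<^sub>R v) = t * fibre_radial u d v"
    and "partial_deriv a (partial_deriv b (fibre_radial u d)) (t *\<^sub>R v)
      = partial_deriv a (partial_deriv b (fibre_radial u d)) v / t"
proof -
  have grad: "warp_grad x l (t *\<^sub>R y) = 1 * warp_grad x l y" if "y \<noteq> 0" for y
    using that by (simp add: warp_grad_def M.fund_inverse_scale[OF x _ t])
  have rate: "warp_rate x (t *\<^sub>R y) = t * warp_rate x y" for y
    by (simp add: warp_rate_def sum_distrib_left mult_ac)
  have sq: "sq H2 u (t *\<^sub>R v) = t\<^sup>2 * sq H2 u v" for v
    by (rule N.sq_scale[OF u t])
  have radial: "fibre_radial u d (t *\<^sub>R v) = t * fibre_radial u d v" if "v \<noteq> 0" for v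
    using that by (simp add: fibre_radial_def N.fund_inverse_scale[OF u _ t]
        N.deriv_y_sq_scale[OF u _ t] sum_distrib_left mult_ac)
  \<comment> \<open>Stated over an arbitrary index type, because it is applied in both y and
    v.\<close>
  have twice: "partial_deriv i (partial_deriv j f) (t *\<^sub>R y) =
      c / t / t * partial_deriv i (partial_deriv j f) y"
    if "smooth_on (- {0}) f" "\<And>y. y \<noteq> 0 \<Longrightarrow> f (t *\<^sub>R y) = c * f y" "y \<noteq> 0"
    for i j :: "'k::finite" and f c and y :: "real ^ 'k"
    using that by (intro partial_deriv_scale_nonzero[OF _ t]) (simp_all add: smooth_intros)
  show "warp_grad x l (t *\<^sub>R y) = warp_grad x l y" using grad[OF y] by simp
  show "warp_rate x (t *\<^sub>R y) = t * warp_rate x y" by (rule rate)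
  show "sq H2 u (t *\<^sub>R v) = t\<^sup>2 * sq H2 u v" by (rule sq)
  show "fibre_radial u d (t *\<^sub>R v) = t * fibre_radial u d v" by (rule radial[OF v])
  show "partial_deriv j (partial_deriv k (warp_grad x l)) (t *\<^sub>R y)
      = partial_deriv j (partial_deriv k (warp_grad x l)) y / t\<^sup>2"
    using twice[OF smooth_coefficients(1) grad y] by (simp add: power2_eq_square)
  show "partial_deriv j (partial_deriv k (warp_rate x)) (t *\<^sub>R y)
      = partial_deriv j (partial_deriv k (warp_rate x)) y / t"
    using twice[OF smooth_coefficients(2) rate y] t by simp
  show "partial_deriv a (partial_deriv b (sq H2 u)) (t *\<^sub>R v)
      = partial_deriv a (partial_deriv b (sq H2 u)) v"
    using twice[OF N.smooth_sq_slice[OF u] sq v] t by (simp add: power2_eq_square)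
  show "partial_deriv a (partial_deriv b (fibre_radial u d)) (t *\<^sub>R v)
      = partial_deriv a (partial_deriv b (fibre_radial u d)) v / t"
    using twice[OF smooth_coefficients(3) radial v] t by simp
qed

lemmas spray_intros = separated_spray smooth_intros

text \<open>This and the next three lemmas treat the index patterns that survive the trace: the free
  index in either block, and the two traced indices together in one block. The upper index
  \<open>Inl l\<close> or \<open>Inr d\<close> selects the spray coefficient.\<close>

lemma berwald_Inl_Inl:
  assumes "left_part w \<noteq> 0" "right_part w \<noteq> 0"
  shows "berwald H (Inl l) (Inl i) (Inl j) (Inl k) z w =
      berwald H1 l i j k x (left_part w)
      + partial_deriv i (partial_deriv j (partial_deriv k (warp_grad x l))) (left_part w) * sq H2 u (right_part w)"
    and "berwald H (Inr d) (Inl i) (Inl j) (Inl k) z w =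
      partial_deriv i (partial_deriv j (partial_deriv k (warp_rate x))) (left_part w) * fibre_radial u d (right_part w)"
proof -
  have w': "left_part w \<in> - {0}" "right_part w \<in> - {0}" using assms by auto
  have "separated (- {0}) (- {0})
     (partial_deriv (Inl i) (partial_deriv (Inl j) (partial_deriv (Inl k) (spray_coeff H (Inl l) z))))
     (partial_deriv i (partial_deriv j (partial_deriv k (spray_coeff H1 l x)))) (\<lambda>_. 1)
     (partial_deriv i (partial_deriv j (partial_deriv k (warp_grad x l)))) (sq H2 u)"
    by (intro separated_Inl spray_intros)
  from separatedD[OF this w']
  show "berwald H (Inl l) (Inl i) (Inl j) (Inl k) z w =
      berwald H1 l i j k x (left_part w)
      + partial_deriv i (partial_deriv j (partial_deriv k (warp_grad x l))) (left_part w) * sq H2 u (right_part w)"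
    by (simp add: berwald_def deriv_y_eq)
  have "separated (- {0}) (- {0})
     (partial_deriv (Inl i) (partial_deriv (Inl j) (partial_deriv (Inl k) (spray_coeff H (Inr d) z))))
     (partial_deriv i (partial_deriv j (partial_deriv k (\<lambda>_. 1)))) (spray_coeff H2 d u)
     (partial_deriv i (partial_deriv j (partial_deriv k (warp_rate x)))) (fibre_radial u d)"
    by (intro separated_Inl spray_intros)
  from separatedD[OF this w']
  show "berwald H (Inr d) (Inl i) (Inl j) (Inl k) z w =
      partial_deriv i (partial_deriv j (partial_deriv k (warp_rate x))) (left_part w) * fibre_radial u d (right_part w)"
    by (simp add: berwald_def deriv_y_eq)
qed

text \<open>For lower indices from both blocks the sprays of the factors drop out, since each
  depends on one vector only; the warping terms alone remain.\<close>

lemma berwald_Inl_Inr: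
  assumes "left_part w \<noteq> 0" "right_part w \<noteq> 0"
  shows "berwald H (Inl l) (Inl i) (Inr b) (Inr c) z w =
      partial_deriv i (warp_grad x l) (left_part w)
        * partial_deriv b (partial_deriv c (sq H2 u)) (right_part w)"
    and "berwald H (Inr d) (Inl i) (Inr b) (Inr c) z w =
      partial_deriv i (warp_rate x) (left_part w)
        * partial_deriv b (partial_deriv c (fibre_radial u d)) (right_part w)"
proof -
  have w': "left_part w \<in> - {0}" "right_part w \<in> - {0}" using assms by auto
  have "separated (- {0}) (- {0})
     (partial_deriv (Inl i) (partial_deriv (Inr b) (partial_deriv (Inr c) (spray_coeff H (Inl l) z))))
     (partial_deriv i (spray_coeff H1 l x)) (partial_deriv b (partial_deriv c (\<lambda>_. 1)))
     (partial_deriv i (warp_grad x l)) (partial_deriv b (partial_deriv c (sq H2 u)))"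
    by (intro separated_Inl separated_Inr spray_intros)
  from separatedD[OF this w']
  show "berwald H (Inl l) (Inl i) (Inr b) (Inr c) z w =
      partial_deriv i (warp_grad x l) (left_part w)
        * partial_deriv b (partial_deriv c (sq H2 u)) (right_part w)"
    by (simp add: berwald_def deriv_y_eq)
  have "separated (- {0}) (- {0})
     (partial_deriv (Inl i) (partial_deriv (Inr b) (partial_deriv (Inr c) (spray_coeff H (Inr d) z))))
     (partial_deriv i (\<lambda>_. 1)) (partial_deriv b (partial_deriv c (spray_coeff H2 d u)))
     (partial_deriv i (warp_rate x)) (partial_deriv b (partial_deriv c (fibre_radial u d)))"
    by (intro separated_Inl separated_Inr spray_intros)
  from separatedD[OF this w']
  show "berwald H (Inr d) (Inl i) (Inr b) (Inr c) z w =
      partial_deriv i (warp_rate x) (left_part w)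
        * partial_deriv b (partial_deriv c (fibre_radial u d)) (right_part w)"
    by (simp add: berwald_def deriv_y_eq)
qed

lemma berwald_Inr_Inl:
  assumes "left_part w \<noteq> 0" "right_part w \<noteq> 0"
  shows "berwald H (Inl l) (Inr a) (Inl j) (Inl k) z w =
      partial_deriv j (partial_deriv k (warp_grad x l)) (left_part w)
        * partial_deriv a (sq H2 u) (right_part w)"
    and "berwald H (Inr d) (Inr a) (Inl j) (Inl k) z w =
      partial_deriv j (partial_deriv k (warp_rate x)) (left_part w)
        * partial_deriv a (fibre_radial u d) (right_part w)"
proof -
  have w': "left_part w \<in> - {0}" "right_part w \<in> - {0}" using assms by auto
  have "separated (- {0}) (- {0})
     (partial_deriv (Inr a) (partial_deriv (Inl j) (partial_deriv (Inl k) (spray_coeff H (Inl l) z))))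
     (partial_deriv j (partial_deriv k (spray_coeff H1 l x))) (partial_deriv a (\<lambda>_. 1))
     (partial_deriv j (partial_deriv k (warp_grad x l))) (partial_deriv a (sq H2 u))"
    by (intro separated_Inl separated_Inr spray_intros)
  from separatedD[OF this w']
  show "berwald H (Inl l) (Inr a) (Inl j) (Inl k) z w =
      partial_deriv j (partial_deriv k (warp_grad x l)) (left_part w)
        * partial_deriv a (sq H2 u) (right_part w)"
    by (simp add: berwald_def deriv_y_eq)
  have "separated (- {0}) (- {0})
     (partial_deriv (Inr a) (partial_deriv (Inl j) (partial_deriv (Inl k) (spray_coeff H (Inr d) z))))
     (partial_deriv j (partial_deriv k (\<lambda>_. 1))) (partial_deriv a (spray_coeff H2 d u))
     (partial_deriv j (partial_deriv k (warp_rate x))) (partial_deriv a (fibre_radial u d))"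
    by (intro separated_Inl separated_Inr spray_intros)
  from separatedD[OF this w']
  show "berwald H (Inr d) (Inr a) (Inl j) (Inl k) z w =
      partial_deriv j (partial_deriv k (warp_rate x)) (left_part w)
        * partial_deriv a (fibre_radial u d) (right_part w)"
    by (simp add: berwald_def deriv_y_eq)
qed

lemma berwald_Inr_Inr:
  assumes "left_part w \<noteq> 0" "right_part w \<noteq> 0"
  shows "berwald H (Inl l) (Inr a) (Inr b) (Inr c) z w = warp_grad x l (left_part w)
        * partial_deriv a (partial_deriv b (partial_deriv c (sq H2 u))) (right_part w)"
    and "berwald H (Inr d) (Inr a) (Inr b) (Inr c) z w = berwald H2 d a b c u (right_part w)
      + warp_rate x (left_part w)
        * partial_deriv a (partial_deriv b (partial_deriv c (fibre_radial u d))) (right_part w)"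
proof -
  have w': "left_part w \<in> - {0}" "right_part w \<in> - {0}" using assms by auto
  have "separated (- {0}) (- {0})
     (partial_deriv (Inr a) (partial_deriv (Inr b) (partial_deriv (Inr c) (spray_coeff H (Inl l) z))))
     (spray_coeff H1 l x) (partial_deriv a (partial_deriv b (partial_deriv c (\<lambda>_. 1))))
     (warp_grad x l) (partial_deriv a (partial_deriv b (partial_deriv c (sq H2 u))))"
    by (intro separated_Inr spray_intros)
  from separatedD[OF this w']
  show "berwald H (Inl l) (Inr a) (Inr b) (Inr c) z w = warp_grad x l (left_part w)
        * partial_deriv a (partial_deriv b (partial_deriv c (sq H2 u))) (right_part w)"
    by (simp add: berwald_def deriv_y_eq)
  have "separated (- {0}) (- {0})
     (partial_deriv (Inr a) (partial_deriv (Inr b) (partial_deriv (Inr c) (spray_coeff H (Inr d) z))))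
     (\<lambda>_. 1) (partial_deriv a (partial_deriv b (partial_deriv c (spray_coeff H2 d u))))
     (warp_rate x) (partial_deriv a (partial_deriv b (partial_deriv c (fibre_radial u d))))"
    by (intro separated_Inr spray_intros)
  from separatedD[OF this w']
  show "berwald H (Inr d) (Inr a) (Inr b) (Inr c) z w = berwald H2 d a b c u (right_part w)
      + warp_rate x (left_part w)
        * partial_deriv a (partial_deriv b (partial_deriv c (fibre_radial u d))) (right_part w)"
    by (simp add: berwald_def deriv_y_eq)
qed

lemma laurent_landsberg:
  assumes "\<And>l. laurent (\<lambda>t. y_lower H l z (f t) * berwald H l \<alpha> \<beta> \<gamma> z (f t))"
  shows "laurent (\<lambda>t. landsberg H \<alpha> \<beta> \<gamma> z (f t))"
  unfolding landsberg_def by (intro laurent_cmult laurent_sum assms)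

text \<open>Degrees in v: an upper index in the first block gives 0 from the curvature of the first
  factor and 2 from F_2^2. An upper index in the second block gives 1 + 1, from y_l and the radial
  factor.\<close>

lemma laurent_landsberg_Inl_Inl:
  "laurent (\<lambda>t. landsberg H (Inl i) (Inl j) (Inl k) z (join_parts y (t *\<^sub>R v)))"
proof (rule laurent_landsberg)
  fix L :: "'m + 'n"
  show "laurent (\<lambda>t. y_lower H L z (join_parts y (t *\<^sub>R v))
      * berwald H L (Inl i) (Inl j) (Inl k) z (join_parts y (t *\<^sub>R v)))"
  proof (cases L)
    case (Inl l)
    show ?thesis
      by (rule laurentI[of _ 0 "y_lower H1 l x y * berwald H1 l i j k x y" 0
          "y_lower H1 l x y * partial_deriv i (partial_deriv j (partial_deriv k (warp_grad x l))) y * sq H2 u v"])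
        (use y v in \<open>simp add: Inl y_lower_warped[OF base_in_domain] berwald_Inl_Inl coefficient_scale base_parts algebra_simps\<close>)
  next
    case (Inr d)
    show ?thesis
      by (rule laurentI[of _ 0 0 0 "\<phi> x * y_lower H2 d u v
          * partial_deriv i (partial_deriv j (partial_deriv k (warp_rate x))) y * fibre_radial u d v"])
        (use y v in \<open>simp add: Inr y_lower_warped[OF base_in_domain] N.y_lower_scale[OF u] berwald_Inl_Inl
          coefficient_scale base_parts power2_eq_square\<close>)
  qed
qed

text \<open>Two derivatives in v leave degree 0 for F_2^2 and -1 for the radial factor; the latter
  is compensated by degree 1 of y_l, so everything is constant in t.\<close>

lemma laurent_landsberg_Inl_Inr:
  "laurent (\<lambda>t. landsberg H (Inl i) (Inr b) (Inr c) z (join_parts y (t *\<^sub>R v)))"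
proof (rule laurent_landsberg)
  fix L :: "'m + 'n"
  show "laurent (\<lambda>t. y_lower H L z (join_parts y (t *\<^sub>R v))
      * berwald H L (Inl i) (Inr b) (Inr c) z (join_parts y (t *\<^sub>R v)))"
  proof (cases L)
    case (Inl l)
    show ?thesis
      by (rule laurentI[of _ 0 "y_lower H1 l x y * (partial_deriv i (warp_grad x l) y
            * partial_deriv b (partial_deriv c (sq H2 u)) v)" 0 0])
        (use y v in \<open>simp add: Inl y_lower_warped[OF base_in_domain] berwald_Inl_Inr coefficient_scale base_parts\<close>)
  next
    case (Inr d)
    show ?thesis
      by (rule laurentI[of _ 0 "\<phi> x * y_lower H2 d u v * partial_deriv i (warp_rate x) y
            * partial_deriv b (partial_deriv c (fibre_radial u d)) v" 0 0])
        (use y v in \<open>simp add: Inr y_lower_warped[OF base_in_domain] N.y_lower_scale[OF u] berwald_Inl_Inr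
          coefficient_scale base_parts\<close>)
  qed
qed

text \<open>The only source of 1/t: two derivatives in y give degree -2 for the gradient factor,
  times degree 1 of y_l, or degree -1 for the rate, with y_l fixed.\<close>

lemma laurent_landsberg_Inr_Inl:
  "laurent (\<lambda>t. landsberg H (Inr a) (Inl j) (Inl k) z (join_parts (t *\<^sub>R y) v))"
proof (rule laurent_landsberg)
  fix L :: "'m + 'n"
  show "laurent (\<lambda>t. y_lower H L z (join_parts (t *\<^sub>R y) v)
      * berwald H L (Inr a) (Inl j) (Inl k) z (join_parts (t *\<^sub>R y) v))"
  proof (cases L)
    case (Inl l)
    show ?thesis
      by (rule laurentI[of _ "y_lower H1 l x y * partial_deriv j (partial_deriv k (warp_grad x l)) y
            * partial_deriv a (sq H2 u) v" 0 0 0])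
        (use y v in \<open>simp add: Inl y_lower_warped[OF base_in_domain] M.y_lower_scale[OF x] berwald_Inr_Inl
          coefficient_scale base_parts power2_eq_square\<close>)
  next
    case (Inr d)
    show ?thesis
      by (rule laurentI[of _ "\<phi> x * y_lower H2 d u v
            * partial_deriv j (partial_deriv k (warp_rate x)) y * partial_deriv a (fibre_radial u d) v" 0 0 0])
        (use y v in \<open>simp add: Inr y_lower_warped[OF base_in_domain] berwald_Inr_Inl coefficient_scale base_parts\<close>)
  qed
qed

text \<open>No derivative falls on y here: y_l has degree 1 against the gradient factor of degree 0,
  or degree 0 against a constant plus the rate of degree 1.\<close>

lemma laurent_landsberg_Inr_Inr:
  "laurent (\<lambda>t. landsberg H (Inr a) (Inr b) (Inr c) z (join_parts (t *\<^sub>R y) v))"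
proof (rule laurent_landsberg)
  fix L :: "'m + 'n"
  show "laurent (\<lambda>t. y_lower H L z (join_parts (t *\<^sub>R y) v)
      * berwald H L (Inr a) (Inr b) (Inr c) z (join_parts (t *\<^sub>R y) v))"
  proof (cases L)
    case (Inl l)
    show ?thesis
      by (rule laurentI[of _ 0 0 "y_lower H1 l x y * (warp_grad x l y
            * partial_deriv a (partial_deriv b (partial_deriv c (sq H2 u))) v)" 0])
        (use y v in \<open>simp add: Inl y_lower_warped[OF base_in_domain] M.y_lower_scale[OF x] berwald_Inr_Inr
          coefficient_scale base_parts\<close>)
  next
    case (Inr d)
    show ?thesis
      by (rule laurentI[of _ 0 "\<phi> x * y_lower H2 d u v * berwald H2 d a b c u v"
          "\<phi> x * y_lower H2 d u v * (warp_rate x y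
            * partial_deriv a (partial_deriv b (partial_deriv c (fibre_radial u d))) v)" 0])
        (use y v in \<open>simp add: Inr y_lower_warped[OF base_in_domain] berwald_Inr_Inr coefficient_scale base_parts
          algebra_simps\<close>)
  qed
qed

text \<open>The inverse tensors are constant in t: the first block does not see v, and the second is
  homogeneous of degree 0 in it.\<close>

lemma laurent_mean_landsberg_Inl:
  "laurent (\<lambda>t. mean_landsberg H (Inl i) z (join_parts y (t *\<^sub>R v)))"
proof (rule laurent_cong)
  show "laurent (\<lambda>t. (\<Sum>j\<in>UNIV. \<Sum>k\<in>UNIV. fund_inverse H1 j k x y *
        landsberg H (Inl i) (Inl j) (Inl k) z (join_parts y (t *\<^sub>R v)))
   + 1 / \<phi> x * (\<Sum>b\<in>UNIV. \<Sum>c\<in>UNIV.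
        fund_inverse H2 b c u v * landsberg H (Inl i) (Inr b) (Inr c) z (join_parts y (t *\<^sub>R v))))"
    by (intro laurent_add laurent_cmult laurent_sum laurent_landsberg_Inl_Inl laurent_landsberg_Inl_Inr)
qed (use y v in \<open>simp add: mean_landsberg_warped[OF base_in_domain] N.fund_inverse_scale[OF u] base_parts\<close>)

lemma laurent_mean_landsberg_Inr:
  "laurent (\<lambda>t. mean_landsberg H (Inr a) z (join_parts (t *\<^sub>R y) v))"
proof (rule laurent_cong)
  show "laurent (\<lambda>t. (\<Sum>j\<in>UNIV. \<Sum>k\<in>UNIV. fund_inverse H1 j k x y *
        landsberg H (Inr a) (Inl j) (Inl k) z (join_parts (t *\<^sub>R y) v))
   + 1 / \<phi> x * (\<Sum>b\<in>UNIV. \<Sum>c\<in>UNIV.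
        fund_inverse H2 b c u v * landsberg H (Inr a) (Inr b) (Inr c) z (join_parts (t *\<^sub>R y) v)))"
    by (intro laurent_add laurent_cmult laurent_sum laurent_landsberg_Inr_Inl laurent_landsberg_Inr_Inr)
qed (use y v in \<open>simp add: mean_landsberg_warped[OF base_in_domain] M.fund_inverse_scale[OF x] base_parts\<close>)

end

text \<open>The isotropy factor is a number, as the base point is fixed. The equation is assumed for
  all vectors with nonzero parts, so that it may be used along the whole scaled family through
  \<open>w\<close>.\<close>

lemma isotropic_mean_landsberg_zero:
  assumes z: "left_part z \<in> U" "right_part z \<in> V"
    and isotropic: "\<And>w \<alpha>. left_part w \<noteq> 0 \<Longrightarrow> right_part w \<noteq> 0 \<Longrightarrow>
      mean_landsberg H \<alpha> z w = \<kappa> * H z w * mean_cartan_torsion H \<alpha> z w"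
    and w: "left_part w \<noteq> 0" "right_part w \<noteq> 0"
  shows "mean_landsberg H \<alpha> z w = 0"
proof -
  define x u y v where defs: "x = left_part z" "u = right_part z" "y = left_part w" "v = right_part w"
  have x: "x \<in> U" and u: "u \<in> V" and y: "y \<noteq> 0" and v: "v \<noteq> 0"
    and zw: "z = join_parts x u" "w = join_parts y v"
    using z w by (simp_all add: defs)
  define m where "m = (\<kappa> * mean_cartan_torsion H \<alpha> z w)\<^sup>2"
  have A: "sq H1 x y > 0" and B: "\<phi> x * sq H2 u v > 0"
    using M.sq_pos[OF x y] N.sq_pos[OF u v] \<phi>_pos[OF x] by simp_all
  \<comment> \<open>With the torsion component frozen at its value at \<open>w\<close>, the constant
    \<open>m\<close> is the same along the family; at \<open>w\<close> itself, m = 0 gives J =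
    0.\<close>
  have J_sq: "(mean_landsberg H \<alpha> z w')\<^sup>2 = m * sq H z w'"
    if "left_part w' \<noteq> 0" "right_part w' \<noteq> 0"
      "mean_cartan_torsion H \<alpha> z w' = mean_cartan_torsion H \<alpha> z w" for w'
    using isotropic[OF that(1,2)] that(3) by (simp add: m_def sq_def power_mult_distrib)
  have "m = 0"
  proof (cases \<alpha>)
    case (Inl i)
    show ?thesis
    proof (rule laurent_sqrt_quadratic[OF laurent_mean_landsberg_Inl[OF x u zw(1) y v, of i] A B])
      fix t :: real assume "t > 0"
      then show "(mean_landsberg H (Inl i) z (join_parts y (t *\<^sub>R v)))\<^sup>2 =
          m * (sq H1 x y + \<phi> x * sq H2 u v * t\<^sup>2)"
        using J_sq[of "join_parts y (t *\<^sub>R v)"] y v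
          mean_cartan_torsion_warped(1)[OF z, of "join_parts y (t *\<^sub>R v)" i]
          mean_cartan_torsion_warped(1)[OF z w, of i]
        by (simp add: Inl sq_eq x u N.sq_scale mult_ac flip: defs)
    qed
  next
    case (Inr a)
    show ?thesis
    \<comment> \<open>\<open>A\<close> and \<open>B\<close> change places, since the first vector is
      now the scaled one and its term carries t^2.\<close>
    proof (rule laurent_sqrt_quadratic[OF laurent_mean_landsberg_Inr[OF x u zw(1) y v, of a] B A])
      fix t :: real assume "t > 0"
      then show "(mean_landsberg H (Inr a) z (join_parts (t *\<^sub>R y) v))\<^sup>2 =
          m * (\<phi> x * sq H2 u v + sq H1 x y * t\<^sup>2)"
        using J_sq[of "join_parts (t *\<^sub>R y) v"] y v
          mean_cartan_torsion_warped(2)[OF z, of "join_parts (t *\<^sub>R y) v" a]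
          mean_cartan_torsion_warped(2)[OF z w, of a]
        by (simp add: Inr sq_eq x u M.sq_scale algebra_simps flip: defs)
    qed
  qed
  then show ?thesis using J_sq[OF w] by simp
qed

end

section \<open>Coordinate vectors and product charts\<close>

lemma chart_inv_in_dom: "x \<in> chart_image c \<Longrightarrow> chart_inv c x \<in> chart_dom c"
  unfolding chart_image_def chart_inv_def by (rule inv_into_into)

lemma coords_chart_inv: "x \<in> chart_image c \<Longrightarrow> coords c (chart_inv c x) = x"
  unfolding chart_image_def chart_inv_def by (rule f_inv_into_f)

lemma smooth_functionsD:
  "f \<in> smooth_functions \<A> \<Longrightarrow> c \<in> \<A> \<Longrightarrow> smooth_on (chart_image c) (f \<circ> chart_inv c)"
  by (simp add: smooth_functions_def)

lemma coord_vec_0: "coord_vec \<A> c x 0 = zero_tvec"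
  by (simp add: coord_vec_def fun_eq_iff)

lemma coord_vec_scaleR: "coord_vec \<A> c x (r *\<^sub>R y) = (\<lambda>f. r * coord_vec \<A> c x y f)"
  by (simp add: coord_vec_def fun_eq_iff sum_distrib_left mult.assoc)

text \<open>Homogeneity of a metric is assumed on the tangent bundle only, and the slit region also
  requires membership in it, so coordinate vectors must be shown to be derivations.\<close>

lemma coord_vec_in_tangent_space:
  assumes "\<forall>d\<in>\<A>. open (chart_image d)" "c \<in> \<A>" "x \<in> chart_image c"
  shows "coord_vec \<A> c x y \<in> tangent_space \<A> (chart_inv c x)"
proof -
  have diff: "(f \<circ> chart_inv c) differentiable (at x)" if "f \<in> smooth_functions \<A>" for f
    using smooth_on_differentiable[OF smooth_functionsD[OF that assms(2)] assms(3)] .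
  \<comment> \<open>These closure properties keep \<open>coord_vec\<close> off its default value 0
    at multiples, sums and products.\<close>
  have cmult: "(\<lambda>x. a * f x) \<in> smooth_functions \<A>" if "f \<in> smooth_functions \<A>" for f a
    using that assms(1) smooth_on_mult[OF _ smooth_on_const]
    by (fastforce simp: smooth_functions_def o_def)
  have add: "(\<lambda>x. f x + g x) \<in> smooth_functions \<A>"
    if "f \<in> smooth_functions \<A>" "g \<in> smooth_functions \<A>" for f g
    using that assms(1) smooth_on_add by (fastforce simp: smooth_functions_def o_def)
  have mult: "(\<lambda>x. f x * g x) \<in> smooth_functions \<A>"
    if "f \<in> smooth_functions \<A>" "g \<in> smooth_functions \<A>" for f g
    using that assms(1) smooth_on_mult by (fastforce simp: smooth_functions_def o_def)
  have 1: "coord_vec \<A> c x y (\<lambda>x. a * f x) = a * coord_vec \<A> c x y f"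
    if f: "f \<in> smooth_functions \<A>" for f a
  proof -
    have "partial_deriv i ((\<lambda>x. a * f x) \<circ> chart_inv c) x = a * partial_deriv i (f \<circ> chart_inv c) x" for i
      using partial_deriv_cmult[OF diff[OF f]] by (simp add: o_def)
    then show ?thesis using f cmult[OF f] by (simp add: coord_vec_def sum_distrib_left mult_ac)
  qed
  have 2: "coord_vec \<A> c x y (\<lambda>x. f x + g x) = coord_vec \<A> c x y f + coord_vec \<A> c x y g"
    if f: "f \<in> smooth_functions \<A>" and g: "g \<in> smooth_functions \<A>" for f g
  proof -
    have "partial_deriv i ((\<lambda>x. f x + g x) \<circ> chart_inv c) x =
        partial_deriv i (f \<circ> chart_inv c) x + partial_deriv i (g \<circ> chart_inv c) x" for i
      using partial_deriv_add[OF diff[OF f] diff[OF g]] by (simp add: o_def)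
    then show ?thesis
      using f g add[OF f g] by (simp add: coord_vec_def sum.distrib distrib_left)
  qed
  have 3: "coord_vec \<A> c x y (\<lambda>x. f x * g x) =
      f (chart_inv c x) * coord_vec \<A> c x y g + g (chart_inv c x) * coord_vec \<A> c x y f"
    if f: "f \<in> smooth_functions \<A>" and g: "g \<in> smooth_functions \<A>" for f g
  proof -
    have "partial_deriv i ((\<lambda>x. f x * g x) \<circ> chart_inv c) x =
        f (chart_inv c x) * partial_deriv i (g \<circ> chart_inv c) x
        + g (chart_inv c x) * partial_deriv i (f \<circ> chart_inv c) x" for i
      using partial_deriv_mult[OF diff[OF f] diff[OF g]] by (simp add: o_def)
    then show ?thesis
      using f g mult[OF f g]
      by (simp add: coord_vec_def sum.distrib distrib_left sum_distrib_left mult_ac)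
  qed
  have 4: "coord_vec \<A> c x y f = 0" if "f \<notin> smooth_functions \<A>" for f
    using that by (simp add: coord_vec_def)
  show ?thesis
    by (simp add: tangent_space_def 1 2 3 4)
qed

lemma coord_vec_in_tangent_bundle:
  assumes "\<forall>d\<in>\<A>. open (chart_image d)" "c \<in> \<A>" "x \<in> chart_image c"
  shows "(chart_inv c x, coord_vec \<A> c x y) \<in> tangent_bundle \<A>"
  using assms(2) coord_vec_in_tangent_space[OF assms] chart_inv_in_dom[OF assms(3)]
  unfolding tangent_bundle_def by blast

lemma smooth_manifold_chart:
  assumes "smooth_manifold X \<A>" "c \<in> \<A>"
  shows "open (chart_image c)" "inj_on (coords c) (chart_dom c)" "chart_dom c \<subseteq> topspace X"
proof -
  have *: "openin X (chart_dom c)" "open (chart_image c)"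
    "homeomorphic_map (subtopology X (chart_dom c)) (top_of_set (chart_image c)) (coords c)"
    using assms by (auto simp: smooth_manifold_def)
  then show "open (chart_image c)" "chart_dom c \<subseteq> topspace X"
    by (auto dest: openin_subset)
  with homeomorphic_imp_injective_map[OF *(3)] show "inj_on (coords c) (chart_dom c)"
    by (simp add: Int_absorb1)
qed

text \<open>Smoothness and positive definiteness are already stated in charts. Homogeneity transfers
  because coordinate vectors are linear in y and belong to the tangent bundle.\<close>

lemma local_finsler_coord_rep:
  assumes "finsler_manifold X \<A> F" "c \<in> \<A>"
  shows "local_finsler (chart_image c) (coord_rep \<A> c F)"
proof
  have F: "smooth_manifold X \<A>" "finsler_metric \<A> F"
    using assms(1) by (auto simp: finsler_manifold_def)
  have opens: "\<forall>d\<in>\<A>. open (chart_image d)"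
    using smooth_manifold_chart(1)[OF F(1)] by blast
  then show "open (chart_image c)" using assms(2) by blast
  show "smooth_on (chart_image c \<times> - {0}) (\<lambda>(x, y). coord_rep \<A> c F x y)"
    using F(2) assms(2) by (simp add: finsler_metric_def)
  show "coord_rep \<A> c F x (r *\<^sub>R y) = r * coord_rep \<A> c F x y"
    if "x \<in> chart_image c" "r > 0" for x y r
    using F(2) coord_vec_in_tangent_bundle[OF opens assms(2) that(1), of y] that(2)
    by (auto simp: finsler_metric_def coord_rep_def coord_vec_scaleR)
  show "(\<Sum>i\<in>UNIV. \<Sum>j\<in>UNIV. fund_tensor (coord_rep \<A> c F) i j x y * w $ i * w $ j) > 0"
    if "x \<in> chart_image c" "y \<noteq> 0" "w \<noteq> 0" for x y w
    using F(2) assms(2) that by (simp add: finsler_metric_def)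
qed

text \<open>Injectivity of \<open>y \<mapsto> \<Sum>\<^sub>i y\<^sup>i \<partial>/\<partial>x\<^sup>i\<close> at \<open>0\<close> comes for free from the metric, which vanishes on the
  zero vector only; no bump functions are needed.\<close>

lemma coord_vec_eq_0_iff:
  assumes "finsler_manifold X \<A> F" "c \<in> \<A>" "x \<in> chart_image c"
  shows "coord_vec \<A> c x y = zero_tvec \<longleftrightarrow> y = 0"
proof
  interpret local_finsler "chart_image c" "coord_rep \<A> c F"
    by (rule local_finsler_coord_rep[OF assms(1,2)])
  assume 0: "coord_vec \<A> c x y = zero_tvec"
  have "coord_rep \<A> c F x (2 *\<^sub>R y) = coord_rep \<A> c F x y"
    by (simp add: coord_rep_def coord_vec_scaleR 0)
  with homogeneous[OF assms(3), of 2 y] have "sq (coord_rep \<A> c F) x y = 0"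
    by (simp add: sq_def)
  then show "y = 0" using sq_pos[OF assms(3), of y] by force
qed (simp add: coord_vec_0)

section \<open>Product charts and the warped metric in them\<close>

lemma coords_prod_chart:
  "coords (prod_chart c d) (p, q) = join_parts (coords c p) (coords d q)"
  by (simp add: prod_chart_def join_parts_def)

lemma chart_dom_prod_chart: "chart_dom (prod_chart c d) = chart_dom c \<times> chart_dom d"
  by (simp add: prod_chart_def)

lemma chart_image_prod_chart:
  "z \<in> chart_image (prod_chart c d) \<longleftrightarrow>
    left_part z \<in> chart_image c \<and> right_part z \<in> chart_image d"
proof
  assume "z \<in> chart_image (prod_chart c d)"
  then show "left_part z \<in> chart_image c \<and> right_part z \<in> chart_image d"
    by (auto simp: chart_image_def chart_dom_prod_chart coords_prod_chart)
next
  assume "left_part z \<in> chart_image c \<and> right_part z \<in> chart_image d"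
  then obtain p q where "p \<in> chart_dom c" "q \<in> chart_dom d"
    "left_part z = coords c p" "right_part z = coords d q"
    by (auto simp: chart_image_def)
  then have "z = coords (prod_chart c d) (p, q)" "(p, q) \<in> chart_dom (prod_chart c d)"
    by (metis coords_prod_chart join_part) (simp add: chart_dom_prod_chart \<open>p \<in> _\<close> \<open>q \<in> _\<close>)
  then show "z \<in> chart_image (prod_chart c d)"
    unfolding chart_image_def by blast
qed

lemma open_chart_image_prod_chart:
  "open (chart_image c) \<Longrightarrow> open (chart_image d) \<Longrightarrow> open (chart_image (prod_chart c d))"
  using open_parts[of "chart_image c" "chart_image d"]
  by (simp flip: chart_image_prod_chart)

text \<open>All three inverses are choices of preimages; injectivity of the two factor charts forces
  the choices to agree.\<close>

lemma chart_inv_prod_chart: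
  assumes "inj_on (coords c) (chart_dom c)" "inj_on (coords d) (chart_dom d)"
    "z \<in> chart_image (prod_chart c d)"
  shows "chart_inv (prod_chart c d) z = (chart_inv c (left_part z), chart_inv d (right_part z))"
proof -
  obtain p q where pq: "chart_inv (prod_chart c d) z = (p, q)" by fastforce
  have "(p, q) \<in> chart_dom (prod_chart c d)"
    using chart_inv_in_dom[OF assms(3)] pq by simp
  moreover have "coords (prod_chart c d) (p, q) = z"
    using coords_chart_inv[OF assms(3)] pq by simp
  ultimately have "p \<in> chart_dom c" "q \<in> chart_dom d"
    "coords c p = left_part z" "coords d q = right_part z"
    by (auto simp: chart_dom_prod_chart coords_prod_chart)
  then show ?thesis
    using pq assms(1,2) inv_into_f_f unfolding chart_inv_def by metis
qed

lemma partial_deriv_left_part: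
  "partial_deriv (Inl i) (\<lambda>z. g (left_part z)) z = partial_deriv i g (left_part z)"
  "partial_deriv (Inr j) (\<lambda>z. g (left_part z)) z = 0"
  by (simp_all add: partial_deriv_def)

lemma partial_deriv_right_part:
  "partial_deriv (Inl i) (\<lambda>z. g (right_part z)) z = 0"
  "partial_deriv (Inr j) (\<lambda>z. g (right_part z)) z = partial_deriv j g (right_part z)"
  by (simp_all add: partial_deriv_def)

text \<open>In a product chart f \<circ> fst reads as f in the first chart after
  \<open>left_part\<close>, so its derivatives in the second block vanish and the pushforward keeps
  the left part of \<open>w\<close>; symmetrically for \<open>snd\<close>.\<close>

lemma differential_coord_vec:
  fixes \<A> :: "('a, 'm::finite) chart set" and \<B> :: "('b, 'n::finite) chart set"
    and z w :: "real ^ ('m + 'n)"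
  assumes \<A>: "smooth_manifold X \<A>" and \<B>: "smooth_manifold Y \<B>"
    and c: "c \<in> \<A>" and d: "d \<in> \<B>" and z: "z \<in> chart_image (prod_chart c d)"
  defines "v \<equiv> coord_vec (prod_atlas \<A> \<B>) (prod_chart c d) z w"
  shows "differential \<A> fst v = coord_vec \<A> c (left_part z) (left_part w)"
    and "differential \<B> snd v = coord_vec \<B> d (right_part z) (right_part w)"
proof -
  note chA = smooth_manifold_chart[OF \<A>] and chB = smooth_manifold_chart[OF \<B>]
  have opn: "open (chart_image (prod_chart c d))" if "c \<in> \<A>" "d \<in> \<B>" for c d
    by (intro open_chart_image_prod_chart chA chB that)
  \<comment> \<open>The summand 0 gives the right-hand side the form c + L z required by
    \<open>smooth_on_affine\<close>.\<close>
  have fst_eq: "(f \<circ> fst \<circ> chart_inv (prod_chart c d)) z = (f \<circ> chart_inv c) (0 + left_part z)"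
    if "c \<in> \<A>" "d \<in> \<B>" "z \<in> chart_image (prod_chart c d)" for f :: "'a \<Rightarrow> real" and c d z
    using chart_inv_prod_chart[OF chA(2)[OF that(1)] chB(2)[OF that(2)] that(3)] by simp
  have snd_eq: "(f \<circ> snd \<circ> chart_inv (prod_chart c d)) z = (f \<circ> chart_inv d) (0 + right_part z)"
    if "c \<in> \<A>" "d \<in> \<B>" "z \<in> chart_image (prod_chart c d)" for f :: "'b \<Rightarrow> real" and c d z
    using chart_inv_prod_chart[OF chA(2)[OF that(1)] chB(2)[OF that(2)] that(3)] by simp
  \<comment> \<open>Without this the coordinate vector would take its default value 0 at f \<circ>
    fst. It concerns every chart of the product atlas, not just the given one.\<close>
  have fst_smooth: "f \<circ> fst \<in> smooth_functions (prod_atlas \<A> \<B>)" if "f \<in> smooth_functions \<A>" for f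
  proof -
    have "smooth_on (chart_image (prod_chart c d)) (f \<circ> fst \<circ> chart_inv (prod_chart c d))"
      if "c \<in> \<A>" "d \<in> \<B>" for c d
    proof (rule smooth_on_cong[OF opn[OF that]])
      show "smooth_on (chart_image (prod_chart c d)) (\<lambda>z. (f \<circ> chart_inv c) (0 + left_part z))"
        by (rule smooth_on_affine[OF opn[OF that] bounded_linear_left_part _
              smooth_functionsD[OF \<open>f \<in> _\<close> \<open>c \<in> _\<close>]])
          (simp add: chart_image_prod_chart)
    qed (simp only: fst_eq that)
    then show ?thesis by (auto simp: smooth_functions_def prod_atlas_def)
  qed
  have snd_smooth: "f \<circ> snd \<in> smooth_functions (prod_atlas \<A> \<B>)" if "f \<in> smooth_functions \<B>" for f
  proof -
    have "smooth_on (chart_image (prod_chart c d)) (f \<circ> snd \<circ> chart_inv (prod_chart c d))"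
      if "c \<in> \<A>" "d \<in> \<B>" for c d
    proof (rule smooth_on_cong[OF opn[OF that]])
      show "smooth_on (chart_image (prod_chart c d)) (\<lambda>z. (f \<circ> chart_inv d) (0 + right_part z))"
        by (rule smooth_on_affine[OF opn[OF that] bounded_linear_right_part _
              smooth_functionsD[OF \<open>f \<in> _\<close> \<open>d \<in> _\<close>]])
          (simp add: chart_image_prod_chart)
    qed (simp only: snd_eq that)
    then show ?thesis by (auto simp: smooth_functions_def prod_atlas_def)
  qed
  have "partial_deriv k (f \<circ> fst \<circ> chart_inv (prod_chart c d)) z
      = partial_deriv k (\<lambda>z. (f \<circ> chart_inv c) (left_part z)) z" for f :: "'a \<Rightarrow> real" and k
    using fst_eq[OF c d] by (intro partial_deriv_cong[OF opn[OF c d] z]) simp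
  then have "partial_deriv (Inl i) (f \<circ> fst \<circ> chart_inv (prod_chart c d)) z
      = partial_deriv i (f \<circ> chart_inv c) (left_part z)"
    "partial_deriv (Inr j) (f \<circ> fst \<circ> chart_inv (prod_chart c d)) z
      = 0" for f i j
    using partial_deriv_left_part[of _ "f \<circ> chart_inv c" z] by simp_all
  then show "differential \<A> fst v = coord_vec \<A> c (left_part z) (left_part w)"
    unfolding differential_def coord_vec_def v_def using fst_smooth
    by (simp add: fun_eq_iff sum_UNIV_Plus)
  have "partial_deriv k (f \<circ> snd \<circ> chart_inv (prod_chart c d)) z
      = partial_deriv k (\<lambda>z. (f \<circ> chart_inv d) (right_part z)) z" for f :: "'b \<Rightarrow> real" and k
    using snd_eq[OF c d] by (intro partial_deriv_cong[OF opn[OF c d] z]) simp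
  then have "partial_deriv (Inl i) (f \<circ> snd \<circ> chart_inv (prod_chart c d)) z
      = 0"
    "partial_deriv (Inr j) (f \<circ> snd \<circ> chart_inv (prod_chart c d)) z
      = partial_deriv j (f \<circ> chart_inv d) (right_part z)" for f i j
    using partial_deriv_right_part[of _ "f \<circ> chart_inv d" z] by simp_all
  then show "differential \<B> snd v = coord_vec \<B> d (right_part z) (right_part w)"
    unfolding differential_def coord_vec_def v_def using snd_smooth
    by (simp add: fun_eq_iff sum_UNIV_Plus)
qed

text \<open>Turns the invariant region into the coordinate condition under which the local result is
  stated. That a nonzero part gives a nonzero tangent vector is read off from the two factor
  metrics.\<close>

lemma coord_vec_in_slit_product_iff:
  fixes \<A>\<^sub>1 :: "('a, 'm::finite) chart set" and \<A>\<^sub>2 :: "('b, 'n::finite) chart set"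
  assumes M: "finsler_manifold X\<^sub>1 \<A>\<^sub>1 F\<^sub>1" and N: "finsler_manifold X\<^sub>2 \<A>\<^sub>2 F\<^sub>2"
    and c: "c \<in> \<A>\<^sub>1" and d: "d \<in> \<A>\<^sub>2" and z: "z \<in> chart_image (prod_chart c d)"
  shows "(chart_inv (prod_chart c d) z, coord_vec (prod_atlas \<A>\<^sub>1 \<A>\<^sub>2) (prod_chart c d) z w)
      \<in> slit_product \<A>\<^sub>1 \<A>\<^sub>2 \<longleftrightarrow> left_part w \<noteq> 0 \<and> right_part w \<noteq> 0"
proof -
  have mfd: "smooth_manifold X\<^sub>1 \<A>\<^sub>1" "smooth_manifold X\<^sub>2 \<A>\<^sub>2"
    using M N by (auto simp: finsler_manifold_def)
  have "\<forall>e\<in>prod_atlas \<A>\<^sub>1 \<A>\<^sub>2. open (chart_image e)"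
    using smooth_manifold_chart(1)[OF mfd(1)] smooth_manifold_chart(1)[OF mfd(2)]
      open_chart_image_prod_chart
    by (fastforce simp: prod_atlas_def)
  moreover have "prod_chart c d \<in> prod_atlas \<A>\<^sub>1 \<A>\<^sub>2"
    using c d unfolding prod_atlas_def by blast
  ultimately have "(chart_inv (prod_chart c d) z,
      coord_vec (prod_atlas \<A>\<^sub>1 \<A>\<^sub>2) (prod_chart c d) z w) \<in> tangent_bundle (prod_atlas \<A>\<^sub>1 \<A>\<^sub>2)"
    using z by (rule coord_vec_in_tangent_bundle)
  then show ?thesis
    using z by (simp add: slit_product_def differential_coord_vec[OF mfd c d z]
        coord_vec_eq_0_iff[OF M c] coord_vec_eq_0_iff[OF N d] chart_image_prod_chart)
qed

lemma local_warped_coord_rep: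
  fixes \<A>\<^sub>1 :: "('a, 'm::finite) chart set" and \<A>\<^sub>2 :: "('b, 'n::finite) chart set"
  assumes M: "finsler_manifold X\<^sub>1 \<A>\<^sub>1 F\<^sub>1" and N: "finsler_manifold X\<^sub>2 \<A>\<^sub>2 F\<^sub>2"
    and f: "f\<^sub>1 \<in> smooth_functions \<A>\<^sub>1" "\<forall>p\<in>topspace X\<^sub>1. f\<^sub>1 p > 0"
    and c: "c \<in> \<A>\<^sub>1" and d: "d \<in> \<A>\<^sub>2"
  shows "local_warped (chart_image c) (coord_rep \<A>\<^sub>1 c F\<^sub>1) (chart_image d) (coord_rep \<A>\<^sub>2 d F\<^sub>2)
    (\<lambda>x. (f\<^sub>1 (chart_inv c x))\<^sup>2)
    (coord_rep (prod_atlas \<A>\<^sub>1 \<A>\<^sub>2) (prod_chart c d) (warped_metric \<A>\<^sub>1 \<A>\<^sub>2 f\<^sub>1 F\<^sub>1 F\<^sub>2))"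
proof (intro local_warped.intro local_warped_axioms.intro local_finsler_coord_rep[OF M c]
    local_finsler_coord_rep[OF N d])
  have mfd: "smooth_manifold X\<^sub>1 \<A>\<^sub>1" "smooth_manifold X\<^sub>2 \<A>\<^sub>2"
    using M N by (auto simp: finsler_manifold_def)
  note chM = smooth_manifold_chart[OF mfd(1) c] and chN = smooth_manifold_chart[OF mfd(2) d]
  show "smooth_on (chart_image c) (\<lambda>x. (f\<^sub>1 (chart_inv c x))\<^sup>2)"
    using smooth_on_mult[OF chM(1) smooth_functionsD[OF f(1) c] smooth_functionsD[OF f(1) c]]
    by (simp add: power2_eq_square)
  show "(f\<^sub>1 (chart_inv c x))\<^sup>2 > 0" if "x \<in> chart_image c" for x
    using f(2) chM(3) chart_inv_in_dom[OF that] by (metis subsetD zero_less_power)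
  fix z w
  assume "left_part z \<in> chart_image c" "right_part z \<in> chart_image d"
  then have z: "z \<in> chart_image (prod_chart c d)" by (simp add: chart_image_prod_chart)
  show "sq (coord_rep (prod_atlas \<A>\<^sub>1 \<A>\<^sub>2) (prod_chart c d) (warped_metric \<A>\<^sub>1 \<A>\<^sub>2 f\<^sub>1 F\<^sub>1 F\<^sub>2)) z w
      = sq (coord_rep \<A>\<^sub>1 c F\<^sub>1) (left_part z) (left_part w)
        + (f\<^sub>1 (chart_inv c (left_part z)))\<^sup>2 * sq (coord_rep \<A>\<^sub>2 d F\<^sub>2) (right_part z) (right_part w)"
    by (simp add: sq_def coord_rep_def warped_metric_def chart_inv_prod_chart[OF chM(2) chN(2) z]
        differential_coord_vec[OF mfd c d z])
qed

theorem corollary9: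
  fixes X\<^sub>1 :: "'a topology" and X\<^sub>2 :: "'b topology"
    and \<A>\<^sub>1 :: "('a, 'm::finite) chart set" and \<A>\<^sub>2 :: "('b, 'n::finite) chart set"
    and F\<^sub>1 :: "'a \<Rightarrow> 'a tvec \<Rightarrow> real" and F\<^sub>2 :: "'b \<Rightarrow> 'b tvec \<Rightarrow> real"
    and f\<^sub>1 :: "'a \<Rightarrow> real"
  assumes "finsler_manifold X\<^sub>1 \<A>\<^sub>1 F\<^sub>1"
    and "finsler_manifold X\<^sub>2 \<A>\<^sub>2 F\<^sub>2"
    and "f\<^sub>1 \<in> smooth_functions \<A>\<^sub>1"
    and "\<forall>p\<in>topspace X\<^sub>1. f\<^sub>1 p > 0"
    and "rel_isotropic_mean_landsberg_on (slit_product \<A>\<^sub>1 \<A>\<^sub>2) (prod_atlas \<A>\<^sub>1 \<A>\<^sub>2)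
           (warped_metric \<A>\<^sub>1 \<A>\<^sub>2 f\<^sub>1 F\<^sub>1 F\<^sub>2)"
  shows "weakly_landsberg_on (slit_product \<A>\<^sub>1 \<A>\<^sub>2) (prod_atlas \<A>\<^sub>1 \<A>\<^sub>2)
           (warped_metric \<A>\<^sub>1 \<A>\<^sub>2 f\<^sub>1 F\<^sub>1 F\<^sub>2)"
proof -
  let ?\<P> = "prod_atlas \<A>\<^sub>1 \<A>\<^sub>2" and ?F = "warped_metric \<A>\<^sub>1 \<A>\<^sub>2 f\<^sub>1 F\<^sub>1 F\<^sub>2"
  obtain \<kappa> where \<kappa>: "\<And>e z w i. e \<in> ?\<P> \<Longrightarrow> z \<in> chart_image e \<Longrightarrow>
      (chart_inv e z, coord_vec ?\<P> e z w) \<in> slit_product \<A>\<^sub>1 \<A>\<^sub>2 \<Longrightarrow>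
      mean_landsberg (coord_rep ?\<P> e ?F) i z w = \<kappa> (chart_inv e z) * coord_rep ?\<P> e ?F z w
        * mean_cartan_torsion (coord_rep ?\<P> e ?F) i z w"
    using assms(5) unfolding rel_isotropic_mean_landsberg_on_def by blast
  have "mean_landsberg (coord_rep ?\<P> e ?F) i z w = 0"
    if e: "e \<in> ?\<P>" and z: "z \<in> chart_image e"
      and slit: "(chart_inv e z, coord_vec ?\<P> e z w) \<in> slit_product \<A>\<^sub>1 \<A>\<^sub>2" for e z w i
  proof -
    obtain c d where c: "c \<in> \<A>\<^sub>1" and d: "d \<in> \<A>\<^sub>2" and cd: "e = prod_chart c d"
      using e by (auto simp: prod_atlas_def)
    note slit_iff = coord_vec_in_slit_product_iff[OF assms(1,2) c d z[unfolded cd], folded cd]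
    interpret local_warped "chart_image c" "coord_rep \<A>\<^sub>1 c F\<^sub>1" "chart_image d" "coord_rep \<A>\<^sub>2 d F\<^sub>2"
      "\<lambda>x. (f\<^sub>1 (chart_inv c x))\<^sup>2" "coord_rep ?\<P> e ?F"
      unfolding cd by (rule local_warped_coord_rep[OF assms(1-4) c d])
    show ?thesis
    \<comment> \<open>The scalar function depends on the base point alone, so its value at
      \<open>chart_inv e z\<close> is the single constant for all vectors there.\<close>
    proof (rule isotropic_mean_landsberg_zero)
      show "left_part z \<in> chart_image c" "right_part z \<in> chart_image d"
        using z unfolding cd chart_image_prod_chart by simp_all
      show "left_part w \<noteq> 0" "right_part w \<noteq> 0"
        using slit slit_iff by auto
      show "mean_landsberg (coord_rep ?\<P> e ?F) \<alpha> z w = \<kappa> (chart_inv e z) * coord_rep ?\<P> e ?F z w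
        * mean_cartan_torsion (coord_rep ?\<P> e ?F) \<alpha> z w"
        if "left_part w \<noteq> 0" "right_part w \<noteq> 0" for w \<alpha>
        using that slit_iff by (intro \<kappa> e z) auto
    qed
  qed
  then show ?thesis unfolding weakly_landsberg_on_def by blast
qed

end
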